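(* Let $[A]\in\hat V$ be a staircase character. Then for every map $\Lambda:\mathrm{Pl}(A)\to\mathbb F_q$, $(i,j)\mapsto\lambda_{ij}$, there exists precisely one $[B]=[B(\Lambda)]\in\mathcal O_A$ with $B_{ij}=\lambda_{ij}$ for all $(i,j)\in\mathrm{Pl}(A)$. Moreover $$\mathcal O_A=\{[B(\Lambda)]\mid \Lambda:\mathrm{Pl}(A)\to\mathbb F_q\}.$$ In particular, $\mathcal O_A$ contains precisely one core character $[A_0]=[B(\Lambda_0)]$, where $\Lambda_0(i,j)=0$ for all $(i,j)\in\mathrm{Pl}(A)$. As a consequence $$|\mathcal O_A|=q^{|\mathrm{Pl}(A)|}=q^{|\mathrm{Limb}(A)|}=q^{|\mathrm{Limb}(\mathrm{verge}(A))|}=[U:U_{J(A)}].$$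
   Context: Let $p$ be an odd prime, $q$ a power of $p$, $n$ a natural number. Fix one of the types $\mathfrak B_n,\mathfrak C_n,\mathfrak D_n$; set $N=2n+1,\tilde n=n+1$ for $\mathfrak B_n$ and $N=2n,\tilde n=n$ for $\mathfrak C_n,\mathfrak D_n$. Put $\bar i=N+1-i$. Let $S=\sum_{i=1}^n e_{i\bar i}+\sum_{i=n+1}^N\epsilon e_{i\bar i}$, where $e_{ij}$ are the $N\times N$ matrix units, $\epsilon=-1$ for type $\mathfrak C_n$ and $\epsilon=1$ otherwise, $G=\{g\in GL_N(q)\mid g^tSg=S\}$, $\widetilde U=U_N(q)$ the group of upper unitriangular $N\times N$ matrices over $\mathbb F_q$, $U=G\cap\widetilde U$. Let $\mathcal P=\{(i,j)\mid 1\le i<j<\bar i\}$ for types $\mathfrak B_n,\mathfrak D_n$ and $\mathcal P=\{(i,j)\mid 1\le i<j\le\bar i\}$ for type $\mathfrak C_n$. Let $V=\bigoplus_{(i,j)\in\mathcal P}\mathbb F_q e_{ij}$, $\pi:\mathrm{Mat}_{N\times N}(\mathbb F_q)\to V$ the projection setting entries outside $\mathcal P$ to zero, $\kappa(A,B)=\mathrm{tr}(A^tB)$. Fix a nontrivial linear character $\theta$ of $(\mathbb F_q,+)$; for $A\in V$ let $[A]$ be the linear character $B\mapsto\theta(-\kappa(A,B))$ of $(V,+)$, and $\hat V=\{[A]\mid A\in V\}$. $U$ permutes $\hat V$ by $[A].u=[\pi(Au^{-t})]$, $u^{-t}=(u^{-1})^t$; $\mathcal O_A=\{[A].u\mid u\in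 U\}$. Root subgroups: for $(i,j)\in\mathcal P$, $X_{ij}=\{x_{ij}(\alpha)\mid\alpha\in\mathbb F_q\}\le U$, where: type $\mathfrak B_n$: $x_{ij}(\alpha)=1+\alpha e_{ij}-\alpha e_{\bar j\,\bar i}$ if $j\ne n+1$, $x_{i,n+1}(\alpha)=1+\alpha e_{i,n+1}-\alpha e_{n+1,\bar i}-\frac12\alpha^2e_{i\bar i}$; type $\mathfrak C_n$: $x_{ij}(\alpha)=1+\alpha e_{ij}-\alpha e_{\bar j\,\bar i}$ if $j\le n$, $1+\alpha e_{ij}+\alpha e_{\bar j\,\bar i}$ if $n<j<\bar i$, and $x_{i\bar i}(\alpha)=1+\alpha e_{i\bar i}$; type $\mathfrak D_n$: $x_{ij}(\alpha)=1+\alpha e_{ij}-\alpha e_{\bar j\,\bar i}$. Main conditions: $(i,j)\in\mathcal P$ is a main condition of $A$ if $A_{ij}$ is the rightmost nonzero entry in row $i$; it is a left main condition if $j\le\tilde n$ and a right main condition if $j>\tilde n$. Write $\mathrm{main}(A)$ for the set of main conditions. $[A]$ is a staircase character if its main conditions lie in pairwise different columns. Let $[A]$ be staircase. The minor conditions are the positions $(i,\bar j)$ with $(i,j)$ a right main condition (in type $\mathfrak C_n$ the minor condition of $(i,\bar i)$ is the diagonal position $(i,i)\notin\mathcal P$). A supplementary condition is a position $(i,j)\in\mathcal P$ with $j\le\tilde n$ which lies in the same row and to the left of some minor condition or some left main condition, lies in the same column as some minor condition, and is itself neither a minor nor a main condition. $\mathrm{core}(A)$ is the union of the sets of main, minor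 and supplementary conditions for types $\mathfrak B_n,\mathfrak D_n$, and the union of the sets of main and supplementary conditions for type $\mathfrak C_n$. $\mathrm{verge}(A)=\sum_{(i,j)\in\mathrm{main}(A)}A_{ij}e_{ij}$. A staircase $[A]$ is a core character if $\{(i,j)\mid A_{ij}\neq0\}\subseteq\mathrm{core}(A)$. A position $(i,j)\in\mathcal P$ is a place of $A$ if $(i,j)\notin\mathrm{core}(A)$ and it lies in the same row and to the left of a main condition of $A$; $\mathrm{Pl}(A)$ is the set of places. Limbs: for $(i,j)$ with $i<j<\bar i$ the arm is $\mathcal A(i,j)=\{(\bar j,a)\in\mathcal P\}$ (all positions of $\mathcal P$ in row $\bar j$); in type $\mathfrak C_n$, $\mathcal A(i,\bar i)=\{(i,a)\mid i<a<\bar i\}$. The leg of $(i,j)\in\mathcal P$ is $\mathcal L(i,j)=\{(a,j)\in\mathcal P\mid a>i\}$. $\mathrm{Limb}(A)=\bigcup_{(i,j)\in\mathrm{main}(A)}(\mathcal L(i,j)\cup\mathcal A(i,j))$. $J(A)=\mathcal P\setminus\mathrm{Limb}(A)$, and $U_{J(A)}$ is the subgroup of $U$ generated by all $X_{ij}$, $(i,j)\in J(A)$. *)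

theory Defs
  imports
    Complex_Main
    "HOL-Library.FuncSet"
    "HOL-Computational_Algebra.Primes"
    "HOL-Algebra.Generated_Groups"
    "Jordan_Normal_Form.Matrix"
begin

text \<open>
  Positions of matrices are pairs \<open>(i, j)\<close> with \<open>1 \<le> i, j \<le> N\<close>, whereas the library
  matrices are indexed from \<open>0\<close>; \<open>entry\<close> and \<open>mat1\<close> do the translation.  The finite field
  is a type \<open>'a\<close> of the classes \<open>field\<close> and \<open>finite\<close>.
\<close>

datatype classical_type = TypeB | TypeC | TypeD

definition dimN :: "classical_type \<Rightarrow> nat \<Rightarrow> nat" where
  "dimN t n = (case t of TypeB \<Rightarrow> 2 * n + 1 | TypeC \<Rightarrow> 2 * n | TypeD \<Rightarrow> 2 * n)"

definition ntilde :: "classical_type \<Rightarrow> nat \<Rightarrow> nat" where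
  "ntilde t n = (case t of TypeB \<Rightarrow> n + 1 | TypeC \<Rightarrow> n | TypeD \<Rightarrow> n)"

definition bar :: "classical_type \<Rightarrow> nat \<Rightarrow> nat \<Rightarrow> nat" where
  "bar t n i = dimN t n + 1 - i"

definition entry :: "'a mat \<Rightarrow> nat \<Rightarrow> nat \<Rightarrow> 'a" where
  "entry A i j = A $$ (i - 1, j - 1)"

definition mat1 :: "nat \<Rightarrow> (nat \<Rightarrow> nat \<Rightarrow> 'a) \<Rightarrow> 'a mat" where
  "mat1 N f = mat N N (\<lambda>(r, s). f (r + 1) (s + 1))"

definition munit :: "classical_type \<Rightarrow> nat \<Rightarrow> nat \<Rightarrow> nat \<Rightarrow> 'a :: field mat" where
  "munit t n i j = mat1 (dimN t n) (\<lambda>r s. if r = i \<and> s = j then 1 else 0)"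

definition mtrace :: "'a :: comm_monoid_add mat \<Rightarrow> 'a" where
  "mtrace M = (\<Sum>i < dim_row M. M $$ (i, i))"


subsection \<open>The groups\<close>

definition formS :: "classical_type \<Rightarrow> nat \<Rightarrow> 'a :: field mat" where
  "formS t n = mat1 (dimN t n) (\<lambda>i j.
     if j = bar t n i then (if i \<le> n then 1 else if t = TypeC then - 1 else 1) else 0)"

definition GLgrp :: "classical_type \<Rightarrow> nat \<Rightarrow> 'a :: field mat monoid" where
  "GLgrp t n = units_of (ring_mat TYPE('a) (dimN t n) ())"

definition Gset :: "classical_type \<Rightarrow> nat \<Rightarrow> 'a :: field mat set" where
  "Gset t n = {g \<in> carrier (GLgrp t n). g\<^sup>T * formS t n * g = formS t n}"

definition Utilde :: "classical_type \<Rightarrow> nat \<Rightarrow> 'a :: field mat set" where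
  "Utilde t n = {g \<in> carrier_mat (dimN t n) (dimN t n).
     upper_triangular g \<and> (\<forall>i < dimN t n. g $$ (i, i) = 1)}"

definition Ugrp :: "classical_type \<Rightarrow> nat \<Rightarrow> 'a :: field mat monoid" where
  "Ugrp t n = (GLgrp t n)\<lparr>carrier := Gset t n \<inter> Utilde t n\<rparr>"


subsection \<open>The positions, the space \<open>V\<close> and its characters\<close>

definition Pset :: "classical_type \<Rightarrow> nat \<Rightarrow> (nat \<times> nat) set" where
  "Pset t n = {(i, j). 1 \<le> i \<and> i < j \<and> (if t = TypeC then j \<le> bar t n i else j < bar t n i)}"

definition Vset :: "classical_type \<Rightarrow> nat \<Rightarrow> 'a :: field mat set" where
  "Vset t n = {A \<in> carrier_mat (dimN t n) (dimN t n).
     \<forall>i \<in> {1..dimN t n}. \<forall>j \<in> {1..dimN t n}. (i, j) \<notin> Pset t n \<longrightarrow> entry A i j = 0}"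

definition projV :: "classical_type \<Rightarrow> nat \<Rightarrow> 'a :: field mat \<Rightarrow> 'a mat" where
  "projV t n M = mat1 (dimN t n) (\<lambda>i j. if (i, j) \<in> Pset t n then entry M i j else 0)"

definition kappa :: "'a :: field mat \<Rightarrow> 'a mat \<Rightarrow> 'a" where
  "kappa A B = mtrace (A\<^sup>T * B)"

definition nontrivial_additive_character :: "('a :: field \<Rightarrow> complex) \<Rightarrow> bool" where
  "nontrivial_additive_character \<theta> \<longleftrightarrow>
     \<theta> 0 = 1 \<and> (\<forall>x y. \<theta> (x + y) = \<theta> x * \<theta> y) \<and> (\<exists>x. \<theta> x \<noteq> 1)"

text \<open>
  The character \<open>[A]\<close> of \<open>(V, +)\<close>, as a function on \<open>V\<close>: it is \<open>undefined\<close> outside \<open>V\<close>, so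
  that equality of characters is equality on \<open>V\<close>.
\<close>
definition lchar ::
  "classical_type \<Rightarrow> nat \<Rightarrow> ('a :: field \<Rightarrow> complex) \<Rightarrow> 'a mat \<Rightarrow> ('a mat \<Rightarrow> complex)" where
  "lchar t n \<theta> A = (\<lambda>B \<in> Vset t n. \<theta> (- kappa A B))"

text \<open>
  Distinct elements \<open>A\<close> of \<open>V\<close> give distinct characters \<open>[A]\<close>, so that \<open>[A].u\<close> depends on the
  character \<open>[A]\<close> only.
\<close>
definition lchar_act ::
  "classical_type \<Rightarrow> nat \<Rightarrow> ('a :: field \<Rightarrow> complex) \<Rightarrow> 'a mat \<Rightarrow> 'a mat \<Rightarrow> ('a mat \<Rightarrow> complex)" where
  "lchar_act t n \<theta> A u = lchar t n \<theta> (projV t n (A * (inv\<^bsub>GLgrp t n\<^esub> u)\<^sup>T))"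

definition orbit ::
  "classical_type \<Rightarrow> nat \<Rightarrow> ('a :: field \<Rightarrow> complex) \<Rightarrow> 'a mat \<Rightarrow> ('a mat \<Rightarrow> complex) set" where
  "orbit t n \<theta> A = {lchar_act t n \<theta> A u | u. u \<in> carrier (Ugrp t n)}"


subsection \<open>Root subgroups\<close>

definition root_elt :: "classical_type \<Rightarrow> nat \<Rightarrow> nat \<Rightarrow> nat \<Rightarrow> 'a :: field \<Rightarrow> 'a mat" where
  "root_elt t n i j \<alpha> =
     (let I = 1\<^sub>m (dimN t n);
          e = munit t n i j;
          e' = munit t n (bar t n j) (bar t n i)
      in case t of
        TypeB \<Rightarrow>
          if j \<noteq> n + 1 then I + \<alpha> \<cdot>\<^sub>m e - \<alpha> \<cdot>\<^sub>m e'
          else I + \<alpha> \<cdot>\<^sub>m e - \<alpha> \<cdot>\<^sub>m e' - (1 / 2 * \<alpha>\<^sup>2) \<cdot>\<^sub>m munit t n i (bar t n i)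
      | TypeC \<Rightarrow>
          if j \<le> n then I + \<alpha> \<cdot>\<^sub>m e - \<alpha> \<cdot>\<^sub>m e'
          else if j < bar t n i then I + \<alpha> \<cdot>\<^sub>m e + \<alpha> \<cdot>\<^sub>m e'
          else I + \<alpha> \<cdot>\<^sub>m e
      | TypeD \<Rightarrow> I + \<alpha> \<cdot>\<^sub>m e - \<alpha> \<cdot>\<^sub>m e')"

definition root_subgroup :: "classical_type \<Rightarrow> nat \<Rightarrow> nat \<Rightarrow> nat \<Rightarrow> 'a :: field mat set" where
  "root_subgroup t n i j = {root_elt t n i j \<alpha> | \<alpha>. True}"


subsection \<open>Main, minor and supplementary conditions\<close>

definition main_conds :: "classical_type \<Rightarrow> nat \<Rightarrow> 'a :: field mat \<Rightarrow> (nat \<times> nat) set" where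
  "main_conds t n A = {(i, j) \<in> Pset t n. entry A i j \<noteq> 0 \<and>
     (\<forall>k. (i, k) \<in> Pset t n \<and> j < k \<longrightarrow> entry A i k = 0)}"

definition left_main :: "classical_type \<Rightarrow> nat \<Rightarrow> 'a :: field mat \<Rightarrow> (nat \<times> nat) set" where
  "left_main t n A = {(i, j) \<in> main_conds t n A. j \<le> ntilde t n}"

definition right_main :: "classical_type \<Rightarrow> nat \<Rightarrow> 'a :: field mat \<Rightarrow> (nat \<times> nat) set" where
  "right_main t n A = {(i, j) \<in> main_conds t n A. j > ntilde t n}"

definition staircase :: "classical_type \<Rightarrow> nat \<Rightarrow> 'a :: field mat \<Rightarrow> bool" where
  "staircase t n A \<longleftrightarrow>
     (\<forall>(i, j) \<in> main_conds t n A. \<forall>(i', j') \<in> main_conds t n A. (i, j) \<noteq> (i', j') \<longrightarrow> j \<noteq> j')"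

definition minor_conds :: "classical_type \<Rightarrow> nat \<Rightarrow> 'a :: field mat \<Rightarrow> (nat \<times> nat) set" where
  "minor_conds t n A = {(i, bar t n j) | i j. (i, j) \<in> right_main t n A}"

definition supp_conds :: "classical_type \<Rightarrow> nat \<Rightarrow> 'a :: field mat \<Rightarrow> (nat \<times> nat) set" where
  "supp_conds t n A = {(i, j) \<in> Pset t n. j \<le> ntilde t n \<and>
     (\<exists>k. (i, k) \<in> minor_conds t n A \<union> left_main t n A \<and> j < k) \<and>
     (\<exists>r. (r, j) \<in> minor_conds t n A) \<and>
     (i, j) \<notin> minor_conds t n A \<and> (i, j) \<notin> main_conds t n A}"

definition core :: "classical_type \<Rightarrow> nat \<Rightarrow> 'a :: field mat \<Rightarrow> (nat \<times> nat) set" where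
  "core t n A =
     (if t = TypeC then main_conds t n A \<union> supp_conds t n A
      else main_conds t n A \<union> minor_conds t n A \<union> supp_conds t n A)"

definition verge :: "classical_type \<Rightarrow> nat \<Rightarrow> 'a :: field mat \<Rightarrow> 'a mat" where
  "verge t n A =
     mat1 (dimN t n) (\<lambda>i j. if (i, j) \<in> main_conds t n A then entry A i j else 0)"

definition core_character :: "classical_type \<Rightarrow> nat \<Rightarrow> 'a :: field mat \<Rightarrow> bool" where
  "core_character t n A \<longleftrightarrow> staircase t n A \<and>
     {(i, j). i \<in> {1..dimN t n} \<and> j \<in> {1..dimN t n} \<and> entry A i j \<noteq> 0} \<subseteq> core t n A"

definition places :: "classical_type \<Rightarrow> nat \<Rightarrow> 'a :: field mat \<Rightarrow> (nat \<times> nat) set" where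
  "places t n A = {(i, j) \<in> Pset t n. (i, j) \<notin> core t n A \<and>
     (\<exists>k. (i, k) \<in> main_conds t n A \<and> j < k)}"


subsection \<open>Limbs\<close>

definition arm :: "classical_type \<Rightarrow> nat \<Rightarrow> nat \<Rightarrow> nat \<Rightarrow> (nat \<times> nat) set" where
  "arm t n i j =
     (if t = TypeC \<and> j = bar t n i then {(i, a) | a. i < a \<and> a < bar t n i}
      else {(r, a) \<in> Pset t n. r = bar t n j})"

definition leg :: "classical_type \<Rightarrow> nat \<Rightarrow> nat \<Rightarrow> nat \<Rightarrow> (nat \<times> nat) set" where
  "leg t n i j = {(a, b) \<in> Pset t n. b = j \<and> a > i}"

definition Limb :: "classical_type \<Rightarrow> nat \<Rightarrow> 'a :: field mat \<Rightarrow> (nat \<times> nat) set" where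
  "Limb t n A = (\<Union>(i, j) \<in> main_conds t n A. leg t n i j \<union> arm t n i j)"

definition Jset :: "classical_type \<Rightarrow> nat \<Rightarrow> 'a :: field mat \<Rightarrow> (nat \<times> nat) set" where
  "Jset t n A = Pset t n - Limb t n A"

definition UJ :: "classical_type \<Rightarrow> nat \<Rightarrow> 'a :: field mat \<Rightarrow> 'a mat set" where
  "UJ t n A = generate (Ugrp t n) (\<Union>(i, j) \<in> Jset t n A. root_subgroup t n i j)"


subsection \<open>Orbit elements with prescribed entries at the places\<close>

definition has_places ::
  "classical_type \<Rightarrow> nat \<Rightarrow> ('a :: field \<Rightarrow> complex) \<Rightarrow> 'a mat \<Rightarrow> (nat \<times> nat \<Rightarrow> 'a) \<Rightarrow> 'a mat \<Rightarrow> bool" where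
  "has_places t n \<theta> A \<Lambda> B \<longleftrightarrow> B \<in> Vset t n \<and> lchar t n \<theta> B \<in> orbit t n \<theta> A \<and>
     (\<forall>(i, j) \<in> places t n A. entry B i j = \<Lambda> (i, j))"

text \<open>Meaningful only where existence and uniqueness hold.\<close>
definition B_of ::
  "classical_type \<Rightarrow> nat \<Rightarrow> ('a :: field \<Rightarrow> complex) \<Rightarrow> 'a mat \<Rightarrow> (nat \<times> nat \<Rightarrow> 'a) \<Rightarrow> 'a mat" where
  "B_of t n \<theta> A \<Lambda> = (THE B. has_places t n \<theta> A \<Lambda> B)"

end

(*
Since inverses exhaust U, the orbit of [A] consists of the [pi(A w^t)] with w in U. Row i of
pi(A w^t) is row i of A plus combinations of entries further to the right, so the main conditions
and their values are constant on the orbit.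

Existence: a place (i, j) in a row with main condition (i, m) is adjusted by a root element whose
entry at (j, m) is nonzero. Doing this in order of increasing m - j never disturbs the places
already treated.

Uniqueness: the products of the rows of A w^t with respect to S do not depend on w. If (i, j) is a
core position left of the main condition (i, m), then (i', N + 1 - j) is a main condition for some
i', and the invariant product of rows i and i' expresses the entry at (i, j) through entries closer
to their main conditions and through the entry at (i', N + 1 - m). The latter is a place, unless it
is (i, j) itself; then (i, j) occurs twice, and 2 is invertible.

Index: a group element fixes verge(A) iff it vanishes at all (j, m) with i < j < m for some main
condition (i, m). Clearing entries by root elements, in order of increasing height, shows that this
stabilizer is U_J, so its index is the orbit size of verge(A), which has the same places as A.
Folding the positions (j, m) into P along the antidiagonal matches places with limb positions.
*)
theory Submission
  imports Defs "Jordan_Normal_Form.Determinant"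
begin

subsection \<open>The classical groups by matrix entries\<close>

text \<open>The types share one argument. What distinguishes them is the sign \<open>sg\<close>, the
  fixed column n + 1 of type B, where root elements acquire a quadratic entry, and the antidiagonal,
  which carries roots only in type C. Oddness of q enters as 2 \<noteq> 0, wherever an entry is its
  own mirror image outside type C.

  Two obstacles shape the proof. \<open>projV\<close> erases entries, so the form is invariant only
  for pairs of rows whose products stay right of the diagonal. And a root element has two entries of
  equal height, mirrored in the antidiagonal, so adjusting one place might move another of the same
  rank.

  For a main condition (i', \<open>br j\<close>), the same test at (i', \<open>br m\<close>) reads
  \<open>br m\<close> < j. Hence of two different positions of \<open>P\<close> linked in this way
  exactly one is a place.\<close>

locale classical_group =
  fixes t :: classical_type and n :: nat and ty :: "'a :: field itself"
  assumes two_nonzero: "(2 :: 'a) \<noteq> 0"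
begin

abbreviation N where "N \<equiv> dimN t n"
abbreviation br where "br \<equiv> bar t n"
abbreviation P where "P \<equiv> Pset t n"
abbreviation U :: "'a mat set" where "U \<equiv> carrier (Ugrp t n)"

text \<open>The nonzero entry of \<open>S\<close> in row i.\<close>

definition sg :: "nat \<Rightarrow> 'a" where
  "sg i = (if i \<le> n then 1 else if t = TypeC then - 1 else 1)"

lemma sg_sq [simp]: "sg i * sg i = 1" "sg i * (sg i * x) = x"
  by (auto simp: sg_def)

section \<open>Indices and the reflection in the antidiagonal\<close>

definition idx where "idx = {1..N}"

lemma in_idx: "i \<in> idx \<longleftrightarrow> 1 \<le> i \<and> i \<le> N"
  by (simp add: idx_def)

lemma finite_idx [simp]: "finite idx"
  by (simp add: idx_def)

lemma br_in: "i \<in> idx \<Longrightarrow> br i \<in> idx"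
  by (auto simp: bar_def in_idx)

lemma br_br: "i \<in> idx \<Longrightarrow> br (br i) = i"
  by (auto simp: bar_def in_idx)

lemma br_eq_swap: "i \<in> idx \<Longrightarrow> j \<in> idx \<Longrightarrow> (br i = j) = (i = br j)"
  by (auto simp: bar_def in_idx)

lemma br_less: "i \<in> idx \<Longrightarrow> j \<in> idx \<Longrightarrow> (br i < br j) = (j < i)"
  by (auto simp: bar_def in_idx)

lemma br_inj: "i \<in> idx \<Longrightarrow> j \<in> idx \<Longrightarrow> (br i = br j) = (i = j)"
  by (auto simp: bar_def in_idx)

lemma P_bounds: "(i, j) \<in> P \<Longrightarrow> i \<in> idx \<and> j \<in> idx \<and> i < j"
  unfolding in_idx Pset_def bar_def by (auto split: if_splits)

lemma P_iff:
  "i \<in> idx \<Longrightarrow> j \<in> idx \<Longrightarrow>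
    (i, j) \<in> P \<longleftrightarrow> i < j \<and> (j < br i \<or> (t = TypeC \<and> j = br i))"
  by (auto simp: Pset_def in_idx)

lemma finite_P: "finite P"
  by (rule finite_subset[of _ "idx \<times> idx"]) (auto dest: P_bounds)

section \<open>Matrix operations in terms of entries\<close>

lemma entry_mat1: "i \<in> idx \<Longrightarrow> j \<in> idx \<Longrightarrow> entry (mat1 N f) i j = f i j"
  by (auto simp: entry_def mat1_def in_idx)

lemma mat1_carrier [simp]: "mat1 N f \<in> carrier_mat N N"
  by (simp add: mat1_def)

lemma mult_carrier_N [simp]:
  "A \<in> carrier_mat N N \<Longrightarrow> B \<in> carrier_mat N N \<Longrightarrow> A * B \<in> carrier_mat N N"
  by (rule mult_carrier_mat)

lemmas assoc_mult_N = assoc_mult_mat[where n\<^sub>1 = N and n\<^sub>2 = N and n\<^sub>3 = N and n\<^sub>4 = N]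

lemma entry_mult:
  fixes A B :: "'a mat"
  assumes "A \<in> carrier_mat N N" "B \<in> carrier_mat N N" "i \<in> idx" "j \<in> idx"
  shows "entry (A * B) i j = (\<Sum>k\<in>idx. entry A i k * entry B k j)"
proof -
  have "entry (A * B) i j = (\<Sum>k\<in>{0..<N}. A $$ (i - 1, k) * B $$ (k, j - 1))"
    using assms by (auto simp: entry_def scalar_prod_def in_idx)
  also have "\<dots> = (\<Sum>k\<in>idx. entry A i k * entry B k j)"
    by (rule sum.reindex_bij_witness[of _ "\<lambda>k. k - 1" Suc]) (auto simp: entry_def in_idx)
  finally show ?thesis .
qed

lemma entry_transpose:
  "A \<in> carrier_mat N N \<Longrightarrow> i \<in> idx \<Longrightarrow> j \<in> idx \<Longrightarrow> entry (A\<^sup>T) i j = entry A j i"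
  by (auto simp: entry_def in_idx)

lemma entry_one:
  "i \<in> idx \<Longrightarrow> j \<in> idx \<Longrightarrow> entry (1\<^sub>m N :: 'a mat) i j = (if i = j then 1 else 0)"
  by (auto simp: entry_def in_idx)

lemma mat_eq_entryI:
  fixes A B :: "'a mat"
  assumes "A \<in> carrier_mat N N" "B \<in> carrier_mat N N"
    and eq: "\<And>i j. i \<in> idx \<Longrightarrow> j \<in> idx \<Longrightarrow> entry A i j = entry B i j"
  shows "A = B"
proof (rule eq_matI)
  fix i j assume "i < dim_row B" "j < dim_col B"
  then show "A $$ (i, j) = B $$ (i, j)"
    using assms(1,2) eq[of "Suc i" "Suc j"] by (auto simp: entry_def in_idx)
qed (use assms in auto)

text \<open>The adjoint of \<open>w\<close> with respect to \<open>S\<close>, that is \<open>S\<^sup>-\<^sup>1 w\<^sup>T S\<close>: the inverse of \<open>w\<close> when \<open>w\<close> is in \<open>U\<close>.\<close>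
definition star :: "'a mat \<Rightarrow> 'a mat" where
  "star w = mat1 N (\<lambda>i j. sg i * sg j * entry w (br j) (br i))"

section \<open>The form and its adjoint\<close>

abbreviation S :: "'a mat" where "S \<equiv> formS t n"

lemma S_carrier [simp]: "S \<in> carrier_mat N N"
  by (simp add: formS_def)

lemma star_carrier [simp]: "star w \<in> carrier_mat N N"
  by (simp add: star_def)

lemma entry_S: "i \<in> idx \<Longrightarrow> j \<in> idx \<Longrightarrow> entry S i j = (if j = br i then sg i else 0)"
  by (simp add: formS_def entry_mat1 sg_def)

lemma entry_star:
  "i \<in> idx \<Longrightarrow> j \<in> idx \<Longrightarrow> entry (star w) i j = sg i * sg j * entry w (br j) (br i)"
  by (simp add: star_def entry_mat1)

lemma entry_S_mult:
  assumes "M \<in> carrier_mat N N" "i \<in> idx" "j \<in> idx"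
  shows "entry (S * M) i j = sg i * entry M (br i) j"
proof -
  have "entry (S * M) i j = (\<Sum>k\<in>idx. if k = br i then sg i * entry M k j else 0)"
    unfolding entry_mult[OF S_carrier assms] using assms by (intro sum.cong) (auto simp: entry_S)
  then show ?thesis using br_in[OF assms(2)] by (simp add: sum.delta)
qed

lemma entry_mult_S:
  assumes "M \<in> carrier_mat N N" "i \<in> idx" "j \<in> idx"
  shows "entry (M * S) i j = entry M i (br j) * sg (br j)"
proof -
  have "entry (M * S) i j = (\<Sum>k\<in>idx. if k = br j then entry M i k * sg k else 0)"
    unfolding entry_mult[OF assms(1) S_carrier assms(2,3)]
    using assms by (intro sum.cong) (auto simp: entry_S br_br br_in br_eq_swap)
  then show ?thesis using br_in[OF assms(3)] by (simp add: sum.delta)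
qed

text \<open>The sign in \<open>S\<close>^T = \<open>eps\<close> \<open>S\<close>: the form is
  alternating in type C and symmetric otherwise.\<close>

definition eps :: 'a where
  "eps = (if t = TypeC then - 1 else 1)"

lemma eps_sq [simp]: "eps * eps = 1" "eps * (eps * x) = x"
  by (auto simp: eps_def)

lemma sg_br: "i \<in> idx \<Longrightarrow> sg (br i) = eps * sg i"
  unfolding eps_def sg_def bar_def dimN_def in_idx by (cases t) auto

lemma S_mult_transpose: "S * S\<^sup>T = 1\<^sub>m N" "S\<^sup>T * S = 1\<^sub>m N"
proof -
  have c: "S * S\<^sup>T \<in> carrier_mat N N" "S\<^sup>T * S \<in> carrier_mat N N" "S\<^sup>T \<in> carrier_mat N N"
    by simp_all
  show "S * S\<^sup>T = 1\<^sub>m N"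
    by (rule mat_eq_entryI[OF c(1)])
      (auto simp: c(3) entry_S_mult entry_transpose entry_S entry_one br_in br_inj)
  show "S\<^sup>T * S = 1\<^sub>m N"
    by (rule mat_eq_entryI[OF c(2)])
      (auto simp: c(3) entry_mult_S entry_transpose entry_S entry_one br_in br_inj br_br)
qed

lemma star_eq:
  assumes w: "w \<in> carrier_mat N N"
  shows "star w = S\<^sup>T * (w\<^sup>T * S)"
proof (rule mat_eq_entryI)
  fix i j assume ij: "i \<in> idx" "j \<in> idx"
  have "entry (S\<^sup>T * (w\<^sup>T * S)) i j = (\<Sum>k\<in>idx. entry S k i * entry (w\<^sup>T * S) k j)"
    using ij w by (subst entry_mult) (auto simp: entry_transpose intro!: sum.cong)
  also have "\<dots> = (\<Sum>k\<in>idx. if k = br i then sg k * (entry w (br j) k * sg (br j)) else 0)"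
    using ij w by (intro sum.cong) (auto simp: transpose_carrier_mat[of w N N] entry_mult_S entry_transpose entry_S br_in br_br)
  also have "\<dots> = entry (star w) i j"
    using ij by (simp add: sum.delta br_in entry_star sg_br)
  finally show "entry (star w) i j = entry (S\<^sup>T * (w\<^sup>T * S)) i j" ..
qed (use w in auto)

text \<open>\<open>S\<close>^T is the inverse of \<open>S\<close>, so the two equations differ by
  multiplication with an invertible matrix.\<close>

lemma star_mult_eq_one_iff:
  assumes w: "w \<in> carrier_mat N N"
  shows "star w * w = 1\<^sub>m N \<longleftrightarrow> w\<^sup>T * S * w = S"
proof -
  have e: "star w * w = S\<^sup>T * (w\<^sup>T * S * w)"
    unfolding star_eq[OF w] using w
    by (simp add: assoc_mult_N)
  show ?thesis
  proof
    assume "w\<^sup>T * S * w = S"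
    then show "star w * w = 1\<^sub>m N" using e by (simp add: S_mult_transpose)
  next
    assume "star w * w = 1\<^sub>m N"
    then have "S * (S\<^sup>T * (w\<^sup>T * S * w)) = S"
      using e by (simp only: right_mult_one_mat[OF S_carrier])
    moreover have "S * (S\<^sup>T * (w\<^sup>T * S * w)) = (S * S\<^sup>T) * (w\<^sup>T * S * w)"
      using w by (simp add: assoc_mult_N)
    moreover have "w\<^sup>T * S * w \<in> carrier_mat N N" using w by simp
    ultimately show "w\<^sup>T * S * w = S"
      by (simp only: S_mult_transpose left_mult_one_mat)
  qed
qed

section \<open>The group U\<close>

lemma GL_simps [simp]:
  "x \<otimes>\<^bsub>GLgrp t n\<^esub> y = x * y" "\<one>\<^bsub>GLgrp t n\<^esub> = 1\<^sub>m N"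
  by (auto simp: GLgrp_def units_of_def ring_mat_def)

lemma GL_carrier_iff:
  "(g :: 'a mat) \<in> carrier (GLgrp t n) \<longleftrightarrow>
     g \<in> carrier_mat N N \<and> (\<exists>h \<in> carrier_mat N N. h * g = 1\<^sub>m N \<and> g * h = 1\<^sub>m N)"
  by (auto simp: GLgrp_def units_of_def ring_mat_def Units_def)

lemma GL_group: "group (GLgrp t n :: 'a mat monoid)"
  unfolding GLgrp_def by (rule monoid.units_group) (rule ring.is_monoid[OF ring_mat])

lemma U_simps [simp]: "x \<otimes>\<^bsub>Ugrp t n\<^esub> y = x * y" "\<one>\<^bsub>Ugrp t n\<^esub> = 1\<^sub>m N"
  by (auto simp: Ugrp_def)

text \<open>A left inverse of a square matrix is two-sided, so the one equation
  \<open>star w * w = 1\<^sub>m N\<close> yields both invertibility and invariance of the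
  form.\<close>

lemma U_iff: "w \<in> U \<longleftrightarrow> w \<in> Utilde t n \<and> star w * w = 1\<^sub>m N"
proof
  assume "w \<in> U"
  then show "w \<in> Utilde t n \<and> star w * w = 1\<^sub>m N"
    by (auto simp: Ugrp_def Gset_def GL_carrier_iff star_mult_eq_one_iff)
next
  assume w: "w \<in> Utilde t n \<and> star w * w = 1\<^sub>m N"
  then have c: "w \<in> carrier_mat N N" by (auto simp: Utilde_def)
  have "w * star w = 1\<^sub>m N"
    by (rule mat_mult_left_right_inverse[OF _ c]) (use w in auto)
  then have "w \<in> carrier (GLgrp t n)" using c w
    by (auto simp: GL_carrier_iff intro!: bexI[of _ "star w"])
  then show "w \<in> U" using w c by (auto simp: Ugrp_def Gset_def star_mult_eq_one_iff)
qed

lemma U_mat [simp]: "w \<in> U \<Longrightarrow> w \<in> carrier_mat N N"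
  by (auto simp: U_iff Utilde_def)

lemma star_left: "w \<in> U \<Longrightarrow> star w * w = 1\<^sub>m N"
  by (auto simp: U_iff)

lemma star_right: "w \<in> U \<Longrightarrow> w * star w = 1\<^sub>m N"
  by (rule mat_mult_left_right_inverse[of "star w" N w]) (auto simp: star_left)

lemma U_in_GL: "w \<in> U \<Longrightarrow> w \<in> carrier (GLgrp t n)"
  by (auto simp: Ugrp_def Gset_def)

lemma star_in_GL: "w \<in> U \<Longrightarrow> star w \<in> carrier (GLgrp t n)"
  by (auto simp: GL_carrier_iff star_left star_right intro!: bexI[of _ w])

lemma GL_inv_eq_star: "w \<in> U \<Longrightarrow> inv\<^bsub>GLgrp t n\<^esub> w = star w"
  using group.inv_equality[OF GL_group, of "star w" w] by (simp add: star_left U_in_GL star_in_GL)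

lemma Utilde_iff:
  "w \<in> Utilde t n \<longleftrightarrow> w \<in> carrier_mat N N \<and>
    (\<forall>i \<in> idx. \<forall>j \<in> idx. j < i \<longrightarrow> entry w i j = 0) \<and> (\<forall>i \<in> idx. entry w i i = 1)"
    (is "?L \<longleftrightarrow> ?R")
proof
  assume L: ?L
  have "w $$ (i - 1, j - 1) = 0" if "i \<in> idx" "j \<in> idx" "j < i" for i j
  proof -
    have "i - 1 < dim_row w" "j - 1 < i - 1" using L that by (auto simp: Utilde_def in_idx)
    then show ?thesis using L by (simp add: Utilde_def upper_triangular_def)
  qed
  moreover have "w $$ (i - 1, i - 1) = 1" if "i \<in> idx" for i
  proof -
    have "i - 1 < N" using that by (auto simp: in_idx)
    then show ?thesis using L by (simp add: Utilde_def)
  qed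
  ultimately show ?R using L by (simp add: Utilde_def entry_def)
next
  assume R: ?R
  have "w $$ (i, j) = 0" if "i < N" "j < i" for i j
    using R[THEN conjunct2, THEN conjunct1, rule_format, of "Suc i" "Suc j"] that
    by (simp add: entry_def in_idx)
  moreover have "w $$ (i, i) = 1" if "i < N" for i
    using R[THEN conjunct2, THEN conjunct2, rule_format, of "Suc i"] that
    by (simp add: entry_def in_idx)
  ultimately show ?L using R by (auto simp: Utilde_def upper_triangular_def)
qed

lemma U_below: "w \<in> U \<Longrightarrow> i \<in> idx \<Longrightarrow> j < i \<Longrightarrow> j \<in> idx \<Longrightarrow> entry w i j = 0"
  and U_diag: "w \<in> U \<Longrightarrow> i \<in> idx \<Longrightarrow> entry w i i = 1"
  unfolding U_iff Utilde_iff by blast+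

lemma star_star: "w \<in> carrier_mat N N \<Longrightarrow> star (star w) = w"
  by (rule mat_eq_entryI) (simp_all add: entry_star br_in br_br sg_br mult_ac)

text \<open>Up to signs the adjoint is the reflection in the antidiagonal, which preserves upper
  unitriangular matrices; on the diagonal the two signs cancel.\<close>

lemma star_in_U:
  assumes w: "w \<in> U" shows "star w \<in> U"
proof -
  have "entry (star w) i j = 0" if "i \<in> idx" "j \<in> idx" "j < i" for i j
    unfolding entry_star[OF that(1,2)]
    using U_below[OF w br_in[OF that(2)] _ br_in[OF that(1)]] br_less[OF that(1,2)] that(3) by simp
  moreover have "entry (star w) i i = 1" if "i \<in> idx" for i
    unfolding entry_star[OF that that] using U_diag[OF w br_in[OF that]] by simp
  ultimately have "star w \<in> Utilde t n" unfolding Utilde_iff using star_carrier by blast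
  moreover have "star (star w) * star w = 1\<^sub>m N"
    by (simp add: star_star[OF U_mat[OF w]] star_right[OF w])
  ultimately show ?thesis unfolding U_iff by blast
qed

lemma one_in_U: "1\<^sub>m N \<in> U"
proof -
  have "star (1\<^sub>m N) = 1\<^sub>m N"
    by (rule mat_eq_entryI) (auto simp: entry_star entry_one br_in br_inj)
  then show ?thesis by (auto simp: U_iff Utilde_iff entry_one)
qed

lemma entry_mult_U:
  fixes v w :: "'a mat"
  assumes "v \<in> Utilde t n" "w \<in> Utilde t n" "i \<in> idx" "j \<in> idx"
  shows "entry (v * w) i j = (\<Sum>k\<in>{i..j}. entry v i k * entry w k j)"
proof -
  have "entry (v * w) i j = (\<Sum>k\<in>idx. entry v i k * entry w k j)"
    by (rule entry_mult) (use assms in \<open>simp_all add: Utilde_iff\<close>)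
  also have "\<dots> = (\<Sum>k\<in>{i..j}. entry v i k * entry w k j)"
    using assms by (intro sum.mono_neutral_right) (auto simp: Utilde_iff in_idx)
  finally show ?thesis .
qed

lemma mult_in_Utilde: "(v :: 'a mat) \<in> Utilde t n \<Longrightarrow> w \<in> Utilde t n \<Longrightarrow> v * w \<in> Utilde t n"
proof (subst Utilde_iff, intro conjI ballI impI)
  assume vw: "v \<in> Utilde t n" "w \<in> Utilde t n"
  show "v * w \<in> carrier_mat N N" using vw by (auto simp: Utilde_def)
  show "entry (v * w) i j = 0" if "i \<in> idx" "j \<in> idx" "j < i" for i j
    using entry_mult_U[OF vw that(1,2)] that(3) by simp
  show "entry (v * w) i i = 1" if "i \<in> idx" for i
    using entry_mult_U[OF vw that that] that vw by (simp add: Utilde_iff)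
qed

lemma mult_in_U:
  assumes "v \<in> U" "w \<in> U" shows "v * w \<in> U"
proof -
  have "(v * w)\<^sup>T * S * (v * w) = w\<^sup>T * (v\<^sup>T * S * v) * w"
  proof -
    have "(v * w)\<^sup>T * S * (v * w) = (w\<^sup>T * v\<^sup>T) * S * (v * w)"
      using assms by (subst transpose_mult[of _ N N _ N]) auto
    also have "\<dots> = w\<^sup>T * (v\<^sup>T * S * v) * w"
      using assms by (simp add: assoc_mult_N)
    finally show ?thesis .
  qed
  also have "\<dots> = S"
    using star_left[OF assms(1)] star_left[OF assms(2)]
    by (simp add: star_mult_eq_one_iff U_mat[OF assms(1)] U_mat[OF assms(2)])
  finally have "star (v * w) * (v * w) = 1\<^sub>m N"
    using assms by (subst star_mult_eq_one_iff) auto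
  then show ?thesis using assms mult_in_Utilde by (auto simp: U_iff)
qed

lemma U_subgroup: "subgroup U (GLgrp t n)"
  by (rule group.subgroupI[OF GL_group])
    (auto simp: U_in_GL GL_inv_eq_star star_in_U mult_in_U intro!: exI[of _ "1\<^sub>m N"] one_in_U)

lemma Ugrp_eq: "Ugrp t n = (GLgrp t n)\<lparr>carrier := U\<rparr>"
  by (simp add: Ugrp_def)

lemma U_group: "group (Ugrp t n :: 'a mat monoid)"
  by (subst Ugrp_eq) (rule subgroup.subgroup_is_group[OF U_subgroup GL_group])

lemma U_inv: "w \<in> U \<Longrightarrow> inv\<^bsub>Ugrp t n\<^esub> w = star w"
  using group.inv_equality[OF U_group, of "star w" w] by (simp add: star_left star_in_U)

end

subsection \<open>The action on V and the root elements\<close>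

context classical_group
begin

abbreviation V :: "'a mat set" where "V \<equiv> Vset t n"
abbreviation mains where "mains \<equiv> main_conds t n"

text \<open>The character \<open>[A].u\<close> belongs to \<open>act (star u) A\<close>. Without the
  inverse the entries of w appear linearly, and the right action becomes a left action with the same
  orbits.\<close>

definition act :: "'a mat \<Rightarrow> 'a mat \<Rightarrow> 'a mat" where
  "act w A = projV t n (A * w\<^sup>T)"

lemma V_mat: "A \<in> V \<Longrightarrow> A \<in> carrier_mat N N"
  by (simp add: Vset_def)

lemma V_outside: "A \<in> V \<Longrightarrow> i \<in> idx \<Longrightarrow> j \<in> idx \<Longrightarrow> (i, j) \<notin> P \<Longrightarrow> entry A i j = 0"
  by (simp add: Vset_def idx_def)

lemma V_iff:
  "A \<in> V \<longleftrightarrow> A \<in> carrier_mat N N \<and> (\<forall>i\<in>idx. \<forall>j\<in>idx. (i, j) \<notin> P \<longrightarrow> entry A i j = 0)"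
  by (simp add: Vset_def idx_def)

lemma P_left: "(i, k) \<in> P \<Longrightarrow> i < j \<Longrightarrow> j \<le> k \<Longrightarrow> (i, j) \<in> P"
  by (auto simp: Pset_def split: if_splits)

lemma V_eqI:
  assumes "A \<in> V" "B \<in> V" "\<And>i j. (i, j) \<in> P \<Longrightarrow> entry A i j = entry B i j"
  shows "A = B"
proof (rule mat_eq_entryI[OF V_mat[OF assms(1)] V_mat[OF assms(2)]])
  fix i j assume "i \<in> idx" "j \<in> idx"
  then show "entry A i j = entry B i j"
    using assms V_outside by (cases "(i, j) \<in> P") auto
qed

lemma projV_in_V: "projV t n M \<in> V"
  by (simp add: V_iff projV_def entry_mat1)

lemma act_in_V: "act w A \<in> V"
  by (simp add: act_def projV_in_V)

lemma entry_mult_transpose: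
  fixes A w :: "'a mat"
  assumes "A \<in> carrier_mat N N" "w \<in> carrier_mat N N" "i \<in> idx" "j \<in> idx"
  shows "entry (A * w\<^sup>T) i j = (\<Sum>k\<in>idx. entry A i k * entry w j k)"
  using assms by (subst entry_mult) (auto simp: entry_transpose intro!: sum.cong)

text \<open>With a position, \<open>P\<close> contains everything between it and the diagonal. So at
  a position right of the diagonal but outside \<open>P\<close> the sum only meets zeros of A, and
  \<open>projV\<close> erases nothing except entries on or below the diagonal.\<close>

lemma entry_act:
  assumes A: "A \<in> V" and w: "w \<in> U" and ij: "i \<in> idx" "j \<in> idx" "i < j"
  shows "entry (act w A) i j = (\<Sum>k\<in>idx. entry A i k * entry w j k)"
proof (cases "(i, j) \<in> P")
  case True
  then show ?thesis
    using ij by (simp add: act_def projV_def entry_mat1 entry_mult_transpose V_mat[OF A] U_mat[OF w])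
next
  case False
  have "entry A i k * entry w j k = 0" if k: "k \<in> idx" for k
  proof (cases "k < j")
    case True
    then show ?thesis using U_below[OF w ij(2) True k] by simp
  next
    case False
    then have "(i, k) \<notin> P" using P_left[of i k j] \<open>(i, j) \<notin> P\<close> ij by auto
    then show ?thesis using V_outside[OF A ij(1) k] by simp
  qed
  then have "(\<Sum>k\<in>idx. entry A i k * entry w j k) = 0" by (intro sum.neutral) blast
  then show ?thesis using False ij by (simp add: act_def projV_def entry_mat1)
qed

text \<open>What the first projection erases never returns: v is upper triangular, so entry (i, j)
  with i < j only draws on columns k \<ge> j.\<close>

lemma act_act:
  assumes A: "A \<in> V" and w: "w \<in> U" and v: "v \<in> U"
  shows "act v (act w A) = act (v * w) A"
proof (rule V_eqI[OF act_in_V act_in_V])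
  fix i j assume "(i, j) \<in> P"
  then have ij: "i \<in> idx" "j \<in> idx" "i < j" using P_bounds by auto
  have "entry (act v (act w A)) i j = (\<Sum>k\<in>idx. entry (act w A) i k * entry v j k)"
    by (rule entry_act[OF act_in_V v ij])
  also have "\<dots> = (\<Sum>k\<in>idx. (\<Sum>l\<in>idx. entry A i l * entry w k l) * entry v j k)"
  proof (rule sum.cong[OF refl])
    fix k assume k: "k \<in> idx"
    show "entry (act w A) i k * entry v j k = (\<Sum>l\<in>idx. entry A i l * entry w k l) * entry v j k"
    proof (cases "k < j")
      case True
      then show ?thesis using U_below[OF v ij(2) True k] by simp
    next
      case False
      then show ?thesis using entry_act[OF A w ij(1) k] ij(3) by simp
    qed
  qed
  also have "\<dots> = (\<Sum>l\<in>idx. entry A i l * (\<Sum>k\<in>idx. entry v j k * entry w k l))"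
    by (simp add: sum_distrib_left sum_distrib_right mult_ac) (rule sum.swap)
  also have "\<dots> = (\<Sum>l\<in>idx. entry A i l * entry (v * w) j l)"
    by (intro sum.cong refl) (simp add: entry_mult[OF U_mat[OF v] U_mat[OF w] ij(2)])
  also have "\<dots> = entry (act (v * w) A) i j"
    by (rule entry_act[OF A mult_in_U[OF v w] ij, symmetric])
  finally show "entry (act v (act w A)) i j = entry (act (v * w) A) i j" .
qed

lemma act_one: "A \<in> V \<Longrightarrow> act (1\<^sub>m N) A = A"
proof (rule V_eqI[OF act_in_V])
  fix i j assume A: "A \<in> V" and "(i, j) \<in> P"
  then have ij: "i \<in> idx" "j \<in> idx" "i < j" using P_bounds by auto
  have "entry (act (1\<^sub>m N) A) i j = (\<Sum>k\<in>idx. if k = j then entry A i k else 0)"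
    unfolding entry_act[OF A one_in_U ij] by (intro sum.cong) (auto simp: entry_one ij)
  then show "entry (act (1\<^sub>m N) A) i j = entry A i j" using ij by (simp add: sum.delta)
qed

lemma act_star: "A \<in> V \<Longrightarrow> w \<in> U \<Longrightarrow> act (star w) (act w A) = A"
  by (simp add: act_act star_in_U star_left act_one)

section \<open>Main conditions under the action\<close>

lemma mains_P: "(i, m) \<in> mains A \<Longrightarrow> (i, m) \<in> P"
  by (auto simp: main_conds_def)

lemma mains_nonzero: "(i, m) \<in> mains A \<Longrightarrow> entry A i m \<noteq> 0"
  by (auto simp: main_conds_def)

lemma mains_right:
  assumes "A \<in> V" "(i, m) \<in> mains A" "m < k" "k \<in> idx"
  shows "entry A i k = 0"
proof (cases "(i, k) \<in> P")
  case True
  then show ?thesis using assms by (auto simp: main_conds_def)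
next
  case False
  then show ?thesis using assms V_outside P_bounds[OF mains_P[OF assms(2)]] by blast
qed

lemma mains_unique: "(i, m) \<in> mains A \<Longrightarrow> (i, m') \<in> mains A \<Longrightarrow> m = m'"
  by (auto simp: main_conds_def) (metis linorder_neqE_nat)

lemma mains_exists:
  assumes A: "A \<in> V" and ij: "i \<in> idx" "j \<in> idx" "entry A i j \<noteq> 0"
  shows "\<exists>m. (i, m) \<in> mains A \<and> j \<le> m"
proof -
  let ?S = "{k \<in> idx. entry A i k \<noteq> 0}"
  have f: "finite ?S" and j: "j \<in> ?S" using ij by auto
  have M: "Max ?S \<in> ?S" "j \<le> Max ?S" using Max_in[OF f] Max_ge[OF f j] j by blast+
  have "(i, Max ?S) \<in> P" using M(1) V_outside[OF A ij(1)] by blast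
  moreover have "entry A i k = 0" if k: "(i, k) \<in> P" "Max ?S < k" for k
  proof (rule ccontr)
    assume "entry A i k \<noteq> 0"
    then have "k \<in> ?S" using P_bounds[OF k(1)] by auto
    then show False using Max_ge[OF f] k(2) by fastforce
  qed
  ultimately have "(i, Max ?S) \<in> mains A" using M(1) by (auto simp: main_conds_def)
  then show ?thesis using M(2) by blast
qed

text \<open>Row i of A ends at m and row j of w starts at j. This window makes m - j the right
  measure for the later inductions.\<close>

lemma entry_act_row:
  assumes A: "A \<in> V" and w: "w \<in> U" and m: "(i, m) \<in> mains A" and j: "j \<in> idx" "i < j"
  shows "entry (act w A) i j = (\<Sum>k\<in>{j..m}. entry A i k * entry w j k)"
proof -
  have i: "i \<in> idx" and mi: "m \<in> idx" using P_bounds[OF mains_P[OF m]] by auto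
  have "{j..m} \<subseteq> idx" using j mi by (auto simp: in_idx)
  moreover have "entry A i k * entry w j k = 0" if "k \<in> idx - {j..m}" for k
    using that mains_right[OF A m, of k] U_below[OF w j(1), of k] by (cases "k < j") auto
  ultimately show ?thesis
    unfolding entry_act[OF A w i j] by (intro sum.mono_neutral_right) auto
qed

lemma mains_act_subset:
  assumes A: "A \<in> V" and w: "w \<in> U"
  shows "mains A \<subseteq> mains (act w A)"
proof safe
  fix i m assume m: "(i, m) \<in> mains A"
  have b: "i \<in> idx" "m \<in> idx" "i < m" using P_bounds[OF mains_P[OF m]] by auto
  have "entry (act w A) i m = entry A i m"
    unfolding entry_act_row[OF A w m b(2,3)] using U_diag[OF w b(2)] by simp
  moreover have "entry (act w A) i k = 0" if "(i, k) \<in> P" "m < k" for k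
    using entry_act_row[OF A w m, of k] P_bounds[OF that(1)] that(2) by simp
  ultimately show "(i, m) \<in> mains (act w A)"
    using m mains_nonzero[OF m] by (auto simp: main_conds_def)
qed

text \<open>The reverse inclusion is the first one applied to \<open>star w\<close>, which undoes
  w.\<close>

lemma mains_act: "A \<in> V \<Longrightarrow> w \<in> U \<Longrightarrow> mains (act w A) = mains A"
  using mains_act_subset[of A w] mains_act_subset[of "act w A" "star w"]
  by (simp add: act_in_V star_in_U act_star)

lemma entry_act_main:
  assumes A: "A \<in> V" and w: "w \<in> U" and m: "(i, m) \<in> mains A"
  shows "entry (act w A) i m = entry A i m"
proof -
  have b: "i \<in> idx" "m \<in> idx" "i < m" using P_bounds[OF mains_P[OF m]] by auto
  show ?thesis
    unfolding entry_act_row[OF A w m b(2,3)] using U_diag[OF w b(2)] by simp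
qed

section \<open>Entries of root elements\<close>

lemma entry_add: "A \<in> carrier_mat N N \<Longrightarrow> B \<in> carrier_mat N N \<Longrightarrow> i \<in> idx \<Longrightarrow> j \<in> idx \<Longrightarrow>
    entry (A + B :: 'a mat) i j = entry A i j + entry B i j"
  and entry_minus: "A \<in> carrier_mat N N \<Longrightarrow> B \<in> carrier_mat N N \<Longrightarrow> i \<in> idx \<Longrightarrow> j \<in> idx \<Longrightarrow>
    entry (A - B :: 'a mat) i j = entry A i j - entry B i j"
  and entry_smult: "A \<in> carrier_mat N N \<Longrightarrow> i \<in> idx \<Longrightarrow> j \<in> idx \<Longrightarrow>
    entry (c \<cdot>\<^sub>m A :: 'a mat) i j = c * entry A i j"
  by (auto simp: entry_def in_idx)

lemma munit_carrier [simp]: "munit t n i j \<in> carrier_mat N N"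
  by (simp add: munit_def)

lemma entry_munit: "r \<in> idx \<Longrightarrow> s \<in> idx \<Longrightarrow>
    entry (munit t n i j :: 'a mat) r s = (if r = i \<and> s = j then 1 else 0)"
  by (simp add: munit_def entry_mat1)

text \<open>
  The entries of \<open>x\<^sub>a\<^sub>b(\<alpha>)\<close>, uniformly in the three types; \<open>b = br b\<close> occurs only for
  \<open>b = n + 1\<close> in type B.
\<close>
definition rt :: "nat \<Rightarrow> nat \<Rightarrow> 'a \<Rightarrow> nat \<Rightarrow> nat \<Rightarrow> 'a" where
  "rt a b \<alpha> l k = (if l = k then 1 else 0) + (if l = a \<and> k = b then \<alpha> else 0)
     + (if l = br b \<and> k = br a \<and> b \<noteq> br a then - (sg a * sg b * \<alpha>) else 0)
     + (if l = a \<and> k = br a \<and> b = br b then - (\<alpha>\<^sup>2 / 2) else 0)"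

lemma fixed_bar_TypeB: "b \<in> idx \<Longrightarrow> b = br b \<longleftrightarrow> t = TypeB \<and> b = n + 1"
  unfolding in_idx bar_def dimN_def by (cases t; auto; presburger)

lemma P_left_half: "(a, b) \<in> P \<Longrightarrow> a \<le> n"
  unfolding Pset_def bar_def dimN_def by (cases t) auto

lemma fixed_bar_eps: "b \<in> idx \<Longrightarrow> b = br b \<Longrightarrow> eps = 1 \<and> (\<forall>i. sg i = 1)"
  unfolding eps_def sg_def using fixed_bar_TypeB by auto

lemma TypeC_if_eq_bar: "(a, b) \<in> P \<Longrightarrow> b = br a \<Longrightarrow> t = TypeC"
  by (auto simp: Pset_def split: if_splits)

text \<open>Since a \<le> n, the sign at the mirrored position is that of -\<open>sg b\<close>,
  which is positive exactly in type C with b > n. The mirrored position coincides with (a, b) iff b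
  = \<open>br a\<close>; this happens only in type C and must not be counted twice.\<close>

lemma entry_root_elt:
  assumes ab: "(a, b) \<in> P" and lk: "l \<in> idx" "k \<in> idx"
  shows "entry (root_elt t n a b \<alpha> :: 'a mat) l k = rt a b \<alpha> l k"
proof -
  have b: "b \<in> idx" and a: "a \<in> idx" and lt: "a < b" using P_bounds[OF ab] by auto
  have sa: "sg a = 1" using P_left_half[OF ab] by (simp add: sg_def)
  let ?e = "\<lambda>l' k' c. if l = l' \<and> k = k' then c else (0 :: 'a)"
  let ?o = "if l = k then 1 else (0 :: 'a)"
  let ?M = "1\<^sub>m N + \<alpha> \<cdot>\<^sub>m munit t n a b - \<alpha> \<cdot>\<^sub>m munit t n (br b) (br a)"
  have M_carrier: "?M \<in> carrier_mat N N" by (auto intro!: minus_carrier_mat)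
  have m: "entry (c \<cdot>\<^sub>m munit t n a' b') l k = ?e a' b' c" for a' b' c
    by (simp add: entry_smult[OF munit_carrier lk] entry_munit[OF lk])
  have sc: "c \<cdot>\<^sub>m munit t n a' b' \<in> carrier_mat N N" for a' b' and c :: 'a
    by simp
  have c0: "1\<^sub>m N + \<alpha> \<cdot>\<^sub>m munit t n a b \<in> carrier_mat N N"
    by simp
  have e0: "entry (1\<^sub>m N + \<alpha> \<cdot>\<^sub>m munit t n a b) l k = ?o + ?e a b \<alpha>"
    by (simp only: entry_add[OF one_carrier_mat sc lk] m entry_one[OF lk])
  have e1: "entry ?M l k = ?o + ?e a b \<alpha> - ?e (br b) (br a) \<alpha>"
    by (simp only: entry_minus[OF c0 sc lk] m e0)
  have e2: "entry (1\<^sub>m N + \<alpha> \<cdot>\<^sub>m munit t n a b + \<alpha> \<cdot>\<^sub>m munit t n (br b) (br a)) l k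
      = ?o + ?e a b \<alpha> + ?e (br b) (br a) \<alpha>"
    by (simp only: entry_add[OF c0 sc lk] m e0)
  have e3: "entry (?M - (1 / 2 * \<alpha>\<^sup>2) \<cdot>\<^sub>m munit t n a (br a)) l k
      = entry ?M l k - ?e a (br a) (\<alpha>\<^sup>2 / 2)"
    by (simp add: entry_minus[OF M_carrier sc lk] m)
  show ?thesis
  proof (cases t)
    case TypeB
    have nb: "(b = br a) = False" using TypeC_if_eq_bar[OF ab] TypeB by auto
    have sb: "sg b = 1" unfolding sg_def using TypeB by simp
    have bb: "(b = br b) = (b = n + 1)" using fixed_bar_TypeB[OF b] TypeB by simp
    have r: "root_elt t n a b \<alpha> =
      (if b \<noteq> n + 1 then ?M else ?M - (1 / 2 * \<alpha>\<^sup>2) \<cdot>\<^sub>m munit t n a (br a))"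
      unfolding root_elt_def Let_def using TypeB by simp
    show ?thesis
    proof (cases "b = n + 1")
      case True
      then have r': "root_elt t n a b \<alpha> = ?M - (1 / 2 * \<alpha>\<^sup>2) \<cdot>\<^sub>m munit t n a (br a)"
        unfolding r by simp
      have b1: "(b = br b) = True" using bb True by simp
      show ?thesis unfolding r' e3 e1 rt_def nb sa sb b1 by simp
    next
      case False
      then have r': "root_elt t n a b \<alpha> = ?M" unfolding r by simp
      have b1: "(b = br b) = False" using bb False by simp
      show ?thesis unfolding r' e1 rt_def nb sa sb b1 by simp
    qed
  next
    case TypeC
    have nb: "(b = br b) = False" using fixed_bar_TypeB[OF b] TypeC by simp
    have l: "b < br a \<or> b = br a" using ab TypeC by (auto simp: Pset_def)
    have bn: "br a > n" using P_left_half[OF ab] TypeC unfolding bar_def dimN_def by simp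
    have r: "root_elt t n a b \<alpha> =
       (if b \<le> n then ?M
          else if b < br a then 1\<^sub>m N + \<alpha> \<cdot>\<^sub>m munit t n a b + \<alpha> \<cdot>\<^sub>m munit t n (br b) (br a)
          else 1\<^sub>m N + \<alpha> \<cdot>\<^sub>m munit t n a b)"
      unfolding root_elt_def Let_def using TypeC by simp
    have sb: "sg b = (if b \<le> n then 1 else - 1)" unfolding sg_def using TypeC by simp
    consider "b \<le> n" "b \<noteq> br a" | "\<not> b \<le> n" "b < br a" | "\<not> b \<le> n" "b = br a"
      using l bn by linarith
    then show ?thesis
    proof cases
      case 1
      then have r': "root_elt t n a b \<alpha> = ?M" unfolding r by simp
      have s: "sg b = 1" and b1: "(b = br a) = False" using sb 1 by auto
      show ?thesis unfolding r' e1 rt_def sa s nb b1 by simp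
    next
      case 2
      then have r': "root_elt t n a b \<alpha>
          = 1\<^sub>m N + \<alpha> \<cdot>\<^sub>m munit t n a b + \<alpha> \<cdot>\<^sub>m munit t n (br b) (br a)"
        unfolding r by simp
      have s: "sg b = - 1" and b1: "(b = br a) = False" using sb 2 by auto
      show ?thesis unfolding r' e2 rt_def sa s nb b1 by simp
    next
      case 3
      then have r': "root_elt t n a b \<alpha> = 1\<^sub>m N + \<alpha> \<cdot>\<^sub>m munit t n a b" unfolding r by simp
      have b1: "(b = br a) = True" using 3 by auto
      show ?thesis unfolding r' e0 rt_def nb b1 by simp
    qed
  next
    case TypeD
    have nb: "(b = br a) = False" using TypeC_if_eq_bar[OF ab] TypeD by auto
    have sb: "sg b = 1" unfolding sg_def using TypeD by simp
    have bb: "(b = br b) = False" using fixed_bar_TypeB[OF b] TypeD by simp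
    have r: "root_elt t n a b \<alpha> = ?M"
      unfolding root_elt_def Let_def using TypeD by simp
    show ?thesis unfolding r e1 rt_def nb sa sb bb by simp
  qed
qed

lemma root_elt_carrier: "root_elt t n a b (\<alpha> :: 'b :: field) \<in> carrier_mat N N"
proof -
  have C: "(case t of TypeB \<Rightarrow> X | TypeC \<Rightarrow> Y | TypeD \<Rightarrow> Z) \<in> C" if "X \<in> C" "Y \<in> C" "Z \<in> C"
    for X Y Z :: "'b mat" and C
    using that by (cases t) auto
  show ?thesis
    unfolding root_elt_def Let_def by (rule C) (auto intro!: minus_carrier_mat add_carrier_mat)
qed

lemma root_elt_in_U:
  assumes ab: "(a, b) \<in> P"
  shows "(root_elt t n a b \<alpha> :: 'a mat) \<in> U"
proof -
  let ?x = "root_elt t n a b \<alpha> :: 'a mat"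
  have b: "b \<in> idx" and a: "a \<in> idx" and lt: "a < b" using P_bounds[OF ab] by auto
  have ba: "b \<le> br a" using ab P_iff[OF a b] by auto
  note bi = br_in[OF a] br_in[OF b]
  have lt': "br b < br a" using br_less[OF b a] lt by simp
  have x: "entry ?x l k = rt a b \<alpha> l k" if "l \<in> idx" "k \<in> idx" for l k
    by (rule entry_root_elt[OF ab that])
  have "?x \<in> Utilde t n"
    unfolding Utilde_iff
  proof (intro conjI ballI impI root_elt_carrier)
    fix i j assume ij: "i \<in> idx" "j \<in> idx"
    show "entry ?x i j = 0" if "j < i"
      unfolding x[OF ij] rt_def using that lt lt' ba by auto
  next
    fix i assume ij: "i \<in> idx"
    show "entry ?x i i = 1"
      unfolding x[OF ij ij] rt_def using lt lt' ba by auto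
  qed
  moreover have "star ?x * ?x = 1\<^sub>m N"
  proof (rule mat_eq_entryI)
    fix i j assume ij: "i \<in> idx" "j \<in> idx"
    \<comment> \<open>The root element differs from the identity only in rows a and
      \<open>br b\<close>, by \<open>?c\<close> and \<open>?d\<close>, so each sum over k collapses
      to three terms.\<close>
    let ?c = "\<lambda>j. (if j = b then \<alpha> else 0) + (if j = br a \<and> b = br b then - (\<alpha>\<^sup>2 / 2) else 0)"
    let ?d = "\<lambda>j. if j = br a \<and> b \<noteq> br a then - (sg a * sg b * \<alpha>) else 0"
    have "entry (star ?x * ?x) i j
      = (\<Sum>k\<in>idx. sg i * sg k * rt a b \<alpha> (br k) (br i) * rt a b \<alpha> k j)"
      unfolding entry_mult[OF star_carrier root_elt_carrier ij]
      by (intro sum.cong refl) (simp add: entry_star ij x br_in)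
    also have "\<dots> = (\<Sum>k\<in>idx. (if k = j then sg i * sg k * rt a b \<alpha> (br k) (br i) else 0)
        + (if k = a then sg i * sg k * rt a b \<alpha> (br k) (br i) * ?c j else 0)
        + (if k = br b then sg i * sg k * rt a b \<alpha> (br k) (br i) * ?d j else 0))"
    proof (intro sum.cong refl)
      fix k
      have r: "rt a b \<alpha> k j
          = (if k = j then 1 else 0) + (if k = a then ?c j else 0) + (if k = br b then ?d j else 0)"
        by (simp add: rt_def)
      have "x * rt a b \<alpha> k j = (if k = j then x else 0)
        + (if k = a then x * ?c j else 0) + (if k = br b then x * ?d j else 0)" for x
        unfolding r by (simp add: distrib_left del: mult_minus_right)
      then show "sg i * sg k * rt a b \<alpha> (br k) (br i) * rt a b \<alpha> k j
        = (if k = j then sg i * sg k * rt a b \<alpha> (br k) (br i) else 0)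
        + (if k = a then sg i * sg k * rt a b \<alpha> (br k) (br i) * ?c j else 0)
        + (if k = br b then sg i * sg k * rt a b \<alpha> (br k) (br i) * ?d j else 0)" .
    qed
    also have "\<dots> = sg i * sg j * rt a b \<alpha> (br j) (br i) + sg i * sg a * rt a b \<alpha> (br a) (br i) * ?c j
        + sg i * sg (br b) * rt a b \<alpha> b (br i) * ?d j"
      using ij a b bi by (simp add: sum.distrib sum.delta br_br)
    also have "rt a b \<alpha> (br a) (br i) = (if i = a then 1 else 0)"
    proof -
      have "br a \<noteq> a" "br a \<noteq> br b" using lt lt' ba by auto
      then show ?thesis using br_inj[OF a ij(1)] by (auto simp: rt_def)
    qed
    also have "rt a b \<alpha> b (br i) = (if i = br b then 1 else 0)
        + (if b = br b \<and> i = a \<and> b \<noteq> br a then - (sg a * sg b * \<alpha>) else 0)"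
      using lt br_inj[OF ij(1) a] br_eq_swap[OF ij(1) b] by (auto simp: rt_def)
    also have "rt a b \<alpha> (br j) (br i) = (if i = j then 1 else 0) + (if j = br a \<and> i = br b then \<alpha> else 0)
       + (if j = b \<and> i = a \<and> b \<noteq> br a then - (sg a * sg b * \<alpha>) else 0)
       + (if j = br a \<and> i = a \<and> b = br b then - (\<alpha>\<^sup>2 / 2) else 0)"
      unfolding rt_def br_inj[OF ij(2,1)] br_inj[OF ij(2) b] br_inj[OF ij(1) a]
        br_eq_swap[OF ij(2) a] br_eq_swap[OF ij(1) b] by (simp add: eq_commute[of i j])
    also have "sg i * sg j * ((if i = j then 1 else 0) + (if j = br a \<and> i = br b then \<alpha> else 0)
       + (if j = b \<and> i = a \<and> b \<noteq> br a then - (sg a * sg b * \<alpha>) else 0)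
       + (if j = br a \<and> i = a \<and> b = br b then - (\<alpha>\<^sup>2 / 2) else 0))
       + sg i * sg a * (if i = a then 1 else 0) * ?c j
        + sg i * sg (br b) * ((if i = br b then 1 else 0)
        + (if b = br b \<and> i = a \<and> b \<noteq> br a then - (sg a * sg b * \<alpha>) else 0)) * ?d j
      = (if i = j then 1 else 0)"
    proof (cases "b = br b")
      case True
      have s: "sg k = 1" for k using fixed_bar_eps[OF b True] by simp
      have nb: "b \<noteq> br a" using True lt' by simp
      \<comment> \<open>The element and its adjoint each contribute -\<alpha>^2/2 at (a,
        \<open>br a\<close>); together these cancel the product \<alpha>^2 of the two linear
        entries. This is the origin of the constant 1/2.\<close>
      have half: "\<alpha>\<^sup>2 / 2 + \<alpha>\<^sup>2 / 2 = \<alpha>\<^sup>2" using two_nonzero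
        by (metis add_divide_distrib mult_2 nonzero_mult_div_cancel_left)
      have tf: "(b = br b) = True" using True by simp
      have ib: "(i = br b) = (i = b)" using True by simp
      show ?thesis unfolding s ib tf using nb lt half
        by (cases "i = a"; cases "i = b"; cases "j = br a"; cases "j = b")
          (auto simp: power2_eq_square algebra_simps)
    next
      case False
      show ?thesis
      proof (cases "b = br a")
        case True
        \<comment> \<open>The single off-diagonal entry is its own mirror image. The alternating
          sign makes it cancel against its adjoint.\<close>
        have "eps = - 1" unfolding eps_def using TypeC_if_eq_bar[OF ab True] by simp
        then have "sg (br a) = - sg a" using sg_br[OF a] by simp
        moreover have "br b = a" using True br_br[OF a] by simp
        ultimately show ?thesis using False True by (auto simp: algebra_simps)
      next
        case nb: False
        have ee: "sg (br b) * sg (br a) = sg a * sg b" using sg_br[OF a] sg_br[OF b] by (simp add: mult_ac)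
        then have e: "sg (br b) * (sg (br a) * z) = sg a * (sg b * z)" for z
          by (metis mult.assoc)
        have ne: "br b \<noteq> a" "br b \<noteq> br a" using nb br_br[OF b] lt' by auto
        show ?thesis using False nb lt ne
          by (cases "i = a"; cases "i = br b"; cases "j = br a"; cases "j = b")
            (auto simp: e ee ee[unfolded mult.commute[of "sg (br b)"]] algebra_simps)
      qed
    qed
    finally show "entry (star ?x * ?x) i j = entry (1\<^sub>m N) i j" by (simp add: entry_one ij)
  qed (simp_all add: root_elt_carrier)
  ultimately show ?thesis by (simp add: U_iff)
qed

end

subsection \<open>Core positions and solvability at the places\<close>

context classical_group
begin

lemma root_elt_entry_self:
  assumes ab: "(a, b) \<in> P"
  shows "entry (root_elt t n a b \<alpha> :: 'a mat) a b = \<alpha>"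
proof -
  have b: "b \<in> idx" and a: "a \<in> idx" and lt: "a < b" using P_bounds[OF ab] by auto
  have "\<not> (b = br a \<and> b = br b)" using br_inj[OF a b] lt by auto
  then show ?thesis unfolding entry_root_elt[OF ab a b] rt_def using lt by auto
qed

text \<open>The quadratic entry does no harm: b = \<open>br b\<close> and a < b force b <
  \<open>br a\<close>, so it lies strictly farther from the diagonal than (a, b).\<close>

lemma root_elt_low_support:
  assumes ab: "(a, b) \<in> P" and lk: "l \<in> idx" "k \<in> idx" "l < k" "k - l \<le> b - a"
    and nz: "entry (root_elt t n a b \<alpha> :: 'a mat) l k \<noteq> 0"
  shows "(l, k) = (a, b) \<or> (l, k) = (br b, br a)"
proof -
  have b: "b \<in> idx" and a: "a \<in> idx" and lt: "a < b" using P_bounds[OF ab] by auto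
  have "\<not> (l = a \<and> k = br a \<and> b = br b)"
  proof
    assume h: "l = a \<and> k = br a \<and> b = br b"
    then have "b < br a" using br_less[OF b a] lt by simp
    then show False using h lk(4) lt by auto
  qed
  then show ?thesis using nz lk(3) unfolding entry_root_elt[OF ab lk(1,2)] rt_def
    by (auto split: if_splits)
qed

text \<open>A position beyond the antidiagonal is the mirror image of one in \<open>P\<close>, hence
  the second entry of a root element. Only antidiagonal positions outside type C are not reached
  this way.\<close>

lemma low_root_exists:
  assumes ab: "a \<in> idx" "b \<in> idx" "a < b" and ne: "b \<noteq> br a \<or> t = TypeC"
  shows "\<exists>x \<in> U. entry x a b = \<alpha> \<and> (\<forall>l \<in> idx. \<forall>k \<in> idx. l < k \<and> k - l \<le> b - a \<and> entry x l k \<noteq> 0 \<longrightarrow>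
     (l, k) = (a, b) \<or> (l, k) = (br b, br a))"
proof (cases "(a, b) \<in> P")
  case True
  then show ?thesis
    by (intro bexI[of _ "root_elt t n a b \<alpha>"])
      (auto simp: root_elt_entry_self root_elt_in_U dest: root_elt_low_support[OF True])
next
  case False
  have gt: "br a < b" using False P_iff[OF ab(1,2)] ab(3) ne by auto
  note bi = br_in[OF ab(1)] br_in[OF ab(2)]
  have bb: "br (br a) = a" "br (br b) = b" using br_br ab by auto
  have lt: "br b < br a" using br_less[OF ab(2,1)] ab(3) by simp
  have P': "(br b, br a) \<in> P" using P_iff[OF bi(2,1)] bb lt gt by simp
  \<comment> \<open>The parameter undoes the sign that the mirrored entry carries.\<close>
  let ?x = "root_elt t n (br b) (br a) (- (sg (br b) * sg (br a) * \<alpha>)) :: 'a mat"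
  have "br b \<noteq> a" using bb gt by auto
  then have "rt (br b) (br a) c a b = - (sg (br b) * sg (br a) * c)" for c
    unfolding rt_def bb using ab(3) gt by auto
  moreover have "sg x * sg y * (sg x * sg y * z) = z" for x y z
  proof -
    have "sg x * sg y * (sg x * sg y * z) = (sg x * sg x) * ((sg y * sg y) * z)"
      by (simp only: mult_ac)
    then show ?thesis by simp
  qed
  ultimately have "entry ?x a b = \<alpha>"
    unfolding entry_root_elt[OF P' ab(1,2)] by simp
  moreover have "br a - br b = b - a" using ab by (auto simp: bar_def in_idx)
  then have "(l, k) = (a, b) \<or> (l, k) = (br b, br a)"
    if "l \<in> idx" "k \<in> idx" "l < k" "k - l \<le> b - a" "entry ?x l k \<noteq> 0" for l k
    using root_elt_low_support[OF P' that(1-3) _ that(5)] that(4) bb by auto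
  ultimately show ?thesis
    by (intro bexI[of _ ?x]) (auto simp: root_elt_in_U[OF P'])
qed

section \<open>Core positions and places in terms of main conditions\<close>

lemma ntilde_iff: "j \<in> idx \<Longrightarrow> j \<le> ntilde t n \<longleftrightarrow> j \<le> br j"
  unfolding in_idx ntilde_def bar_def dimN_def by (cases t) auto

lemma left_main_iff: "(i, k) \<in> left_main t n A \<longleftrightarrow> (i, k) \<in> mains A \<and> k \<le> br k"
  using ntilde_iff P_bounds[OF mains_P] by (auto simp: left_main_def)

lemma minor_conds_iff:
  assumes "j \<in> idx"
  shows "(i, j) \<in> minor_conds t n A \<longleftrightarrow> (i, br j) \<in> mains A \<and> j < br j"
proof
  assume "(i, j) \<in> minor_conds t n A"
  then obtain m where m: "(i, m) \<in> mains A" "\<not> m \<le> ntilde t n" "j = br m"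
    by (auto simp: minor_conds_def right_main_def)
  have mi: "m \<in> idx" using P_bounds[OF mains_P[OF m(1)]] by simp
  then show "(i, br j) \<in> mains A \<and> j < br j" using m ntilde_iff[OF mi] br_br[OF mi] by auto
next
  assume h: "(i, br j) \<in> mains A \<and> j < br j"
  then have "(i, br j) \<in> right_main t n A"
    using ntilde_iff[OF br_in[OF assms]] br_br[OF assms] by (auto simp: right_main_def)
  then show "(i, j) \<in> minor_conds t n A"
    using br_br[OF assms] by (force simp: minor_conds_def)
qed

lemma minor_conds_idx: "(i, j) \<in> minor_conds t n A \<Longrightarrow> j \<in> idx"
  using P_bounds[OF mains_P] br_in by (force simp: minor_conds_def right_main_def)

text \<open>A minor condition in column j is a main condition in column \<open>br j\<close>, with j
  < \<open>br j\<close>. For m in the right half, lying left of the minor condition of row i means j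
  < \<open>br m\<close>; for m \<le> \<open>br m\<close> this inequality follows from j < m. So both
  clauses for supplementary conditions merge, and the minor condition is the case j =
  \<open>br m\<close>.\<close>

lemma core_iff:
  assumes m: "(i, m) \<in> mains A" and ij: "(i, j) \<in> P" and jm: "j < m"
  shows "(i, j) \<in> core t n A \<longleftrightarrow>
    (\<exists>i'. (i', br j) \<in> mains A) \<and> (j < br m \<or> j = br m \<and> t \<noteq> TypeC)"
proof -
  have b: "i \<in> idx" "m \<in> idx" "j \<in> idx" using P_bounds[OF mains_P[OF m]] P_bounds[OF ij] by auto
  have row: "(i, x) \<in> mains A \<longleftrightarrow> x = m" for x using m mains_unique by blast
  have minor: "(i, j) \<in> minor_conds t n A \<longleftrightarrow> br j = m \<and> j < br j"
    unfolding minor_conds_iff[OF b(3)] row ..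
  have k: "(\<exists>k. (i, k) \<in> minor_conds t n A \<union> left_main t n A \<and> j < k)
      \<longleftrightarrow> (br m < m \<and> j < br m) \<or> m \<le> br m"
  proof
    assume "\<exists>k. (i, k) \<in> minor_conds t n A \<union> left_main t n A \<and> j < k"
    then obtain k where k: "(i, k) \<in> minor_conds t n A \<or> (i, k) \<in> left_main t n A" "j < k" by blast
    from k(1) show "(br m < m \<and> j < br m) \<or> m \<le> br m"
    proof
      assume h: "(i, k) \<in> minor_conds t n A"
      have ki: "k \<in> idx" by (rule minor_conds_idx[OF h])
      have "br k = m" "k < br k" using h unfolding minor_conds_iff[OF ki] row by blast+
      then show ?thesis using br_br[OF ki] k(2) by auto
    next
      assume "(i, k) \<in> left_main t n A"
      then have "k = m" "k \<le> br k" unfolding left_main_iff row by blast+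
      then show ?thesis by simp
    qed
  next
    assume "(br m < m \<and> j < br m) \<or> m \<le> br m"
    then show "\<exists>k. (i, k) \<in> minor_conds t n A \<union> left_main t n A \<and> j < k"
    proof
      assume h: "br m < m \<and> j < br m"
      then have "(i, br m) \<in> minor_conds t n A"
        unfolding minor_conds_iff[OF br_in[OF b(2)]] br_br[OF b(2)] using m by blast
      then show ?thesis using h by blast
    next
      assume "m \<le> br m"
      then have "(i, m) \<in> left_main t n A" using left_main_iff m by blast
      then show ?thesis using jm by blast
    qed
  qed
  have supp: "(i, j) \<in> supp_conds t n A \<longleftrightarrow> j < br j \<and> ((br m < m \<and> j < br m) \<or> m \<le> br m)
      \<and> (\<exists>r. (r, br j) \<in> mains A) \<and> br j \<noteq> m"
    unfolding supp_conds_def mem_Collect_eq case_prod_conv k ntilde_iff[OF b(3)] minor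
      minor_conds_iff[OF b(3)] row using ij jm by auto
  have eq: "br j = m \<longleftrightarrow> j = br m" by (rule br_eq_swap[OF b(3,2)])
  have lt: "j < br m \<Longrightarrow> j < br j" "j = br m \<Longrightarrow> j < br j" "m \<le> br m \<Longrightarrow> j < br m"
    using jm b by (auto simp: bar_def in_idx)
  have not_main: "(i, j) \<notin> mains A" unfolding row using jm by simp
  have core: "(i, j) \<in> core t n A \<longleftrightarrow>
      (t \<noteq> TypeC \<and> (i, j) \<in> minor_conds t n A) \<or> (i, j) \<in> supp_conds t n A"
    using not_main unfolding core_def by (split if_split) blast
  have half: "j < br j \<and> ((br m < m \<and> j < br m) \<or> m \<le> br m) \<longleftrightarrow> j < br m" if "j \<noteq> br m"
    using lt(1,3) by (meson not_le)
  show ?thesis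
  proof (cases "j = br m")
    case True
    have e: "br j = m" using eq True by (rule iffD2)
    have ex: "\<exists>i'. (i', br j) \<in> mains A" unfolding e using m by blast
    have n: "\<not> j < br m" using True by simp
    show ?thesis unfolding core minor supp using ex n True e lt(2)[OF True] by simp
  next
    case False
    show ?thesis unfolding core minor supp using half[OF False] False eq by blast
  qed
qed

text \<open>Meaningful only in rows that contain a main condition, in particular in the rows of
  places; it serves to rank the places.\<close>

definition mcol :: "'a mat \<Rightarrow> nat \<Rightarrow> nat" where
  "mcol A i = (THE m. (i, m) \<in> mains A)"

lemma mcol_eq: "(i, m) \<in> mains A \<Longrightarrow> mcol A i = m"
  unfolding mcol_def using mains_unique by blast

lemma place_iff:
  assumes m: "(i, m) \<in> mains A"
  shows "(i, j) \<in> places t n A \<longleftrightarrow> (i, j) \<in> P \<and> j < m \<and>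
    \<not> ((\<exists>i'. (i', br j) \<in> mains A) \<and> (j < br m \<or> j = br m \<and> t \<noteq> TypeC))"
proof -
  have "(\<exists>k. (i, k) \<in> mains A \<and> j < k) \<longleftrightarrow> j < m" using m mains_unique by blast
  then show ?thesis using core_iff[OF m] by (auto simp: places_def)
qed

text \<open>The last conclusion is what \<open>low_root_exists\<close> requires of the position (j,
  m). It holds because outside type C the position with m = \<open>br j\<close> is a minor
  condition, thus core.\<close>

lemma placeE:
  assumes "(i, j) \<in> places t n A"
  obtains m where "(i, m) \<in> mains A" "(i, j) \<in> P" "j < m"
    "\<And>i'. (i', br j) \<in> mains A \<Longrightarrow> \<not> (j < br m \<or> j = br m \<and> t \<noteq> TypeC)"
    "m \<noteq> br j \<or> t = TypeC"
proof -
  obtain m where m: "(i, m) \<in> mains A" using assms by (auto simp: places_def)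
  have j: "j \<in> idx" "m \<in> idx" using assms P_bounds[OF mains_P[OF m]] P_bounds[of i j] by (auto simp: places_def)
  have q: "(i, j) \<in> P" "j < m"
    "\<And>i'. (i', br j) \<in> mains A \<Longrightarrow> \<not> (j < br m \<or> j = br m \<and> t \<noteq> TypeC)"
    using assms unfolding place_iff[OF m] by blast+
  have "m \<noteq> br j \<or> t = TypeC"
  proof (rule disjCI)
    assume "t \<noteq> TypeC"
    show "m \<noteq> br j"
    proof
      assume e: "m = br j"
      then have "j = br m" using br_br[OF j(1)] by simp
      moreover have "(i, br j) \<in> mains A" using m unfolding e .
      ultimately show False using q(3) \<open>t \<noteq> TypeC\<close> by blast
    qed
  qed
  with q show thesis using that[OF m] by blast
qed

section \<open>Prescribing the entries at the places\<close>

lemma staircaseD: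
  assumes "staircase t n A" "(i, m) \<in> mains A" "(i', m) \<in> mains A" shows "i = i'"
  using assms unfolding staircase_def by blast

lemma mains_act_eq: "A \<in> V \<Longrightarrow> w \<in> U \<Longrightarrow> (i, m) \<in> mains A \<Longrightarrow> (i, m) \<in> mains (act w A)"
  by (simp add: mains_act)

text \<open>The two alternatives are the entries of one root element. In the mirrored case each row
  sees the main condition of the other in its test for core positions, which gives
  \<open>br m\<close> \<le> j and j \<le> \<open>br m\<close>. With j = \<open>br m\<close> both
  main conditions lie in column m, and the staircase condition identifies the rows.\<close>

lemma place_collision:
  assumes st: "staircase t n A"
    and m: "(i, m) \<in> mains A" and m': "(i', m') \<in> mains A"
    and p: "(i, j) \<in> places t n A" and p': "(i', j') \<in> places t n A"
    and eq: "(j', m') = (j, m) \<or> (j', m') = (br m, br j)"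
  shows "(i', j') = (i, j)"
  using eq
proof
  assume "(j', m') = (j, m)"
  then show ?thesis using staircaseD[OF st m] m' by blast
next
  assume e: "(j', m') = (br m, br j)"
  have j: "j \<in> idx" "m \<in> idx" using P_bounds[OF mains_P[OF m]] P_bounds[of i j] p
    by (auto simp: places_def)
  have mj: "(i', br j) \<in> mains A" and mm: "(i, br j') \<in> mains A" using e m m' br_br[OF j(2)] by auto
  have "\<not> (j < br m)" using p mj unfolding place_iff[OF m] by blast
  moreover have "\<not> (j' < br m')" using p' mm unfolding place_iff[OF m'] by blast
  ultimately have jm: "j = br m" using e br_br[OF j(1)] by auto
  then have "m' = m" "j' = j" using e br_br[OF j(2)] by auto
  then show ?thesis using staircaseD[OF st m] m' by blast
qed

lemma places_solvable:
  assumes A: "A \<in> V" and st: "staircase t n A" and Q: "finite Q" "Q \<subseteq> places t n A"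
  shows "\<exists>w \<in> U. \<forall>(i, j) \<in> Q. entry (act w A) i j = \<Lambda> (i, j)"
  using Q
proof (induction rule: finite_ranking_induct[where f = "\<lambda>(i, j). mcol A i - j"])
  case empty
  then show ?case using one_in_U by blast
next
  case (insert p Q)
  obtain i j where p: "p = (i, j)" by (cases p)
  have pl: "(i, j) \<in> places t n A" using insert.prems p by simp
  obtain w where w: "w \<in> U" and IH: "\<And>i j. (i, j) \<in> Q \<Longrightarrow> entry (act w A) i j = \<Lambda> (i, j)"
    using insert by blast
  obtain m where m: "(i, m) \<in> mains A" and ij: "(i, j) \<in> P" "j < m" and ne: "m \<noteq> br j \<or> t = TypeC"
    using pl by (rule placeE) blast
  have b: "i \<in> idx" "m \<in> idx" "j \<in> idx" "i < j" using P_bounds[OF mains_P[OF m]] P_bounds[OF ij(1)] by auto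
  define B where "B = act w A"
  have B: "B \<in> V" unfolding B_def by (rule act_in_V)
  have mB: "(i, m) \<in> mains B" if "(i, m) \<in> mains A" for i m unfolding B_def by (rule mains_act_eq[OF A w that])
  have Bm: "entry B i m \<noteq> 0" by (rule mains_nonzero[OF mB[OF m]])
  \<comment> \<open>Entry (i, j) changes by the entry of B at (i, m) times the entry of x at (j, m),
    since x vanishes strictly between j and m in row j. Main values are nonzero, so the quotient
    exists.\<close>
  obtain x where x: "x \<in> U" "entry x j m = (\<Lambda> (i, j) - entry B i j) / entry B i m"
    and low: "\<And>l k. l \<in> idx \<Longrightarrow> k \<in> idx \<Longrightarrow> l < k \<Longrightarrow> k - l \<le> m - j \<Longrightarrow> entry x l k \<noteq> 0 \<Longrightarrow>
      (l, k) = (j, m) \<or> (l, k) = (br m, br j)"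
    using low_root_exists[OF b(3,2) ij(2) ne] by meson
  have new: "entry (act x B) i j = \<Lambda> (i, j)"
  proof -
    have "entry (act x B) i j = (\<Sum>k\<in>{j..m}. entry B i k * entry x j k)"
      by (rule entry_act_row[OF B x(1) mB[OF m] b(3,4)])
    also have "\<dots> = (\<Sum>k\<in>{j, m}. entry B i k * entry x j k)"
    proof (rule sum.mono_neutral_right)
      show "\<forall>k\<in>{j..m} - {j, m}. entry B i k * entry x j k = 0"
      proof
        fix k assume k: "k \<in> {j..m} - {j, m}"
        have ki: "k \<in> idx" using k b by (auto simp: in_idx)
        have "entry x j k = 0"
        proof (rule ccontr)
          assume "entry x j k \<noteq> 0"
          then have "(j, k) = (j, m) \<or> (j, k) = (br m, br j)" using low[OF b(3) ki] k by auto
          then show False using k br_br[OF b(2)] by auto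
        qed
        then show "entry B i k * entry x j k = 0" by simp
      qed
    qed (use ij in auto)
    also have "\<dots> = entry B i j + (\<Lambda> (i, j) - entry B i j)"
      using ij(2) x(2) Bm U_diag[OF x(1) b(3)] by simp
    finally show ?thesis by simp
  qed
  have old: "entry (act x B) i' j' = entry B i' j'" if s: "(i', j') \<in> Q" "(i', j') \<noteq> (i, j)" for i' j'
  proof -
    have pl': "(i', j') \<in> places t n A" using s insert.prems by blast
    obtain m' where m': "(i', m') \<in> mains A" and ij': "(i', j') \<in> P" "j' < m'"
      using pl' by (rule placeE) blast
    have b': "m' \<in> idx" "j' \<in> idx" "i' < j'"
      using P_bounds[OF mains_P[OF m']] P_bounds[OF ij'(1)] by auto
    have h: "m' - j' \<le> m - j"
      using insert.hyps(2)[OF s(1)] p mcol_eq[OF m] mcol_eq[OF m'] by simp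
    have "entry (act x B) i' j' = (\<Sum>k\<in>{j'..m'}. entry B i' k * entry x j' k)"
      by (rule entry_act_row[OF B x(1) mB[OF m'] b'(2,3)])
    also have "\<dots> = (\<Sum>k\<in>{j'}. entry B i' k * entry x j' k)"
    proof (rule sum.mono_neutral_right)
      show "\<forall>k\<in>{j'..m'} - {j'}. entry B i' k * entry x j' k = 0"
      proof
        fix k assume k: "k \<in> {j'..m'} - {j'}"
        have ki: "k \<in> idx" using k b' by (auto simp: in_idx)
        have "entry x j' k = 0"
        proof (rule ccontr)
          assume "entry x j' k \<noteq> 0"
          then have c: "(j', k) = (j, m) \<or> (j', k) = (br m, br j)" using low[OF b'(2) ki] k h by auto
          \<comment> \<open>Both low entries of x have height m - j, the largest rank so far. An
            older place can only be affected in case of a tie, with k equal to its main column, and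
            \<open>place_collision\<close> rules this out.\<close>
          have "br j - br m = m - j" using b by (auto simp: bar_def in_idx)
          then have "k - j' = m - j" using c by auto
          then have "k = m'" using k h by auto
          then have "(j', m') = (j, m) \<or> (j', m') = (br m, br j)" using c by simp
          then show False using place_collision[OF st m m' pl pl'] s(2) by blast
        qed
        then show "entry B i' k * entry x j' k = 0" by simp
      qed
    qed (use ij' in auto)
    also have "\<dots> = entry B i' j'" using U_diag[OF x(1) b'(2)] by simp
    finally show ?thesis .
  qed
  have e: "act x B = act (x * w) A" unfolding B_def by (rule act_act[OF A w x(1)])
  have "entry (act (x * w) A) i' j' = \<Lambda> (i', j')" if s: "(i', j') \<in> insert p Q" for i' j'
  proof (cases "(i', j') = (i, j)")
    case True
    then show ?thesis using new e by simp
  next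
    case False
    then have "(i', j') \<in> Q" using s p by auto
    then show ?thesis using old[OF _ False] IH e B_def by simp
  qed
  then show ?case using mult_in_U[OF x(1) w] by (intro bexI[of _ "x * w"]) auto
qed

end

subsection \<open>The invariant form determines the core entries\<close>

context classical_group
begin

text \<open>Entry (j, l) of the equation w^T \<open>S\<close> w = \<open>S\<close>.\<close>

lemma U_form:
  assumes w: "w \<in> U" and j: "j \<in> idx" and l: "l \<in> idx"
  shows "(\<Sum>k\<in>idx. sg k * entry w k j * entry w (br k) l) = (if l = br j then sg j else 0)"
proof -
  have bl: "br l \<in> idx" by (rule br_in[OF l])
  have "entry (star w * w) (br l) j = (\<Sum>k\<in>idx. sg (br l) * (sg k * entry w k j * entry w (br k) l))"
    unfolding entry_mult[OF star_carrier U_mat[OF w] bl j]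
    by (intro sum.cong refl) (simp add: entry_star bl br_br[OF l] mult_ac)
  then have "sg (br l) * (\<Sum>k\<in>idx. sg k * entry w k j * entry w (br k) l) = (if br l = j then 1 else 0)"
    unfolding star_left[OF w] entry_one[OF bl j] sum_distrib_left[symmetric] by simp
  then have "(\<Sum>k\<in>idx. sg k * entry w k j * entry w (br k) l) = sg (br l) * (if br l = j then 1 else 0)"
    using sg_sq(2)[of "br l" "\<Sum>k\<in>idx. sg k * entry w k j * entry w (br k) l"] by (simp only:)
  then show ?thesis unfolding br_eq_swap[OF l j] by (auto simp: br_br[OF j])
qed

text \<open>Here \<open>M\<close> is A w^T before the projection, and (A w^T) \<open>S\<close> (A
  w^T)^T = A (w^T \<open>S\<close> w) A^T = A \<open>S\<close> A^T.\<close>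

lemma form_rows:
  assumes A: "A \<in> V" and w: "w \<in> U"
  defines "M \<equiv> \<lambda>i k. \<Sum>l\<in>idx. entry A i l * entry w k l"
  shows "(\<Sum>k\<in>idx. sg k * M i k * M i' (br k))
    = (\<Sum>l\<in>idx. sg l * entry A i l * entry A i' (br l))"
proof -
  have "(\<Sum>k\<in>idx. sg k * M i k * M i' (br k))
    = (\<Sum>k\<in>idx. \<Sum>l\<in>idx. \<Sum>l'\<in>idx.
        entry A i l * entry A i' l' * (sg k * entry w k l * entry w (br k) l'))"
  proof (rule sum.cong[OF refl])
    fix k
    have "sg k * M i k * M i' (br k) = sg k * (M i k * M i' (br k))" by (rule mult.assoc)
    also have "\<dots> = (\<Sum>l\<in>idx. \<Sum>l'\<in>idx.
        sg k * (entry A i l * entry w k l * (entry A i' l' * entry w (br k) l')))"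
      unfolding M_def sum_product by (simp only: sum_distrib_left)
    finally show "sg k * M i k * M i' (br k) = (\<Sum>l\<in>idx. \<Sum>l'\<in>idx.
        entry A i l * entry A i' l' * (sg k * entry w k l * entry w (br k) l'))"
      by (simp only: mult_ac)
  qed
  also have "\<dots> = (\<Sum>l\<in>idx. \<Sum>k\<in>idx. \<Sum>l'\<in>idx.
        entry A i l * entry A i' l' * (sg k * entry w k l * entry w (br k) l'))"
    by (rule sum.swap)
  also have "\<dots> = (\<Sum>l\<in>idx. \<Sum>l'\<in>idx. \<Sum>k\<in>idx.
        entry A i l * entry A i' l' * (sg k * entry w k l * entry w (br k) l'))"
    by (rule sum.cong[OF refl]) (rule sum.swap)
  also have "\<dots> = (\<Sum>l\<in>idx. \<Sum>l'\<in>idx. if l' = br l then entry A i l * entry A i' l' * sg l else 0)"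
    by (intro sum.cong refl) (simp add: sum_distrib_left[symmetric] U_form[OF w])
  also have "\<dots> = (\<Sum>l\<in>idx. sg l * entry A i l * entry A i' (br l))"
    by (intro sum.cong refl) (simp add: sum.delta br_in mult_ac)
  finally show ?thesis .
qed

lemma row_sum_eq_zero:
  assumes A: "A \<in> V" and w: "w \<in> U" and m: "(i, m) \<in> mains A" and k: "k \<in> idx" "m < k"
  shows "(\<Sum>l\<in>idx. entry A i l * entry w k l) = 0"
proof (intro sum.neutral ballI)
  fix l assume l: "l \<in> idx"
  show "entry A i l * entry w k l = 0"
  proof (cases "m < l")
    case True
    then show ?thesis using mains_right[OF A m True l] by simp
  next
    case False
    then show ?thesis using U_below[OF w k(1) _ l] k(2) by simp
  qed
qed

text \<open>The hypotheses \<open>lt\<close> keep the window right of the diagonal: its columns k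
  exceed i, and the columns \<open>br k\<close> exceed i', so the projection has changed none of the
  factors. Outside the window one of the two rows is already past its main condition.\<close>

lemma form_invariant:
  assumes A: "A \<in> V" and w: "w \<in> U" and m: "(i, m) \<in> mains A" and m': "(i', m') \<in> mains A"
    and lt: "i < br m'" "i' < br m"
  shows "(\<Sum>k\<in>{br m'..m}. sg k * entry (act w A) i k * entry (act w A) i' (br k))
    = (\<Sum>l\<in>idx. sg l * entry A i l * entry A i' (br l))"
proof -
  have b: "i \<in> idx" "m \<in> idx" "i' \<in> idx" "m' \<in> idx"
    using P_bounds[OF mains_P[OF m]] P_bounds[OF mains_P[OF m']] by auto
  let ?M = "\<lambda>i k. \<Sum>l\<in>idx. entry A i l * entry w k l"
  have sub: "{br m'..m} \<subseteq> idx" using br_in[OF b(4)] b(2) by (auto simp: in_idx)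
  have "(\<Sum>k\<in>{br m'..m}. sg k * entry (act w A) i k * entry (act w A) i' (br k))
      = (\<Sum>k\<in>{br m'..m}. sg k * ?M i k * ?M i' (br k))"
  proof (intro sum.cong refl)
    fix k assume k: "k \<in> {br m'..m}"
    then have ki: "k \<in> idx" using sub by blast
    have "br m \<le> br k" using br_less[OF b(2) ki] k by (auto simp: not_less[symmetric])
    then show "sg k * entry (act w A) i k * entry (act w A) i' (br k) = sg k * ?M i k * ?M i' (br k)"
      using entry_act[OF A w b(1) ki] entry_act[OF A w b(3) br_in[OF ki]] lt k by simp
  qed
  also have "\<dots> = (\<Sum>k\<in>idx. sg k * ?M i k * ?M i' (br k))"
  proof (rule sum.mono_neutral_left[OF finite_idx sub], rule ballI)
    fix k assume k: "k \<in> idx - {br m'..m}"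
    then have ki: "k \<in> idx" by blast
    show "sg k * ?M i k * ?M i' (br k) = 0"
    proof (cases "m < k")
      case True
      then show ?thesis using row_sum_eq_zero[OF A w m ki] by simp
    next
      case False
      then have "k < br m'" using k by auto
      then have "m' < br k" using br_less[OF br_in[OF b(4)] ki] br_br[OF b(4)] by simp
      then show ?thesis using row_sum_eq_zero[OF A w m' br_in[OF ki]] by simp
    qed
  qed
  also have "\<dots> = (\<Sum>l\<in>idx. sg l * entry A i l * entry A i' (br l))"
    by (rule form_rows[OF A w])
  finally show ?thesis .
qed

section \<open>Entries at core positions\<close>

lemma core_entry_determined:
  assumes A: "A \<in> V" and st: "staircase t n A" and w: "w \<in> U" and v: "v \<in> U"
    and pl: "\<And>i j. (i, j) \<in> places t n A \<Longrightarrow> entry (act w A) i j = entry (act v A) i j"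
    and IH: "\<And>i m j. (i, m) \<in> mains A \<Longrightarrow> (i, j) \<in> P \<Longrightarrow> j \<le> m \<Longrightarrow> m - j < h \<Longrightarrow>
      entry (act w A) i j = entry (act v A) i j"
    and m: "(i, m) \<in> mains A" and ij: "(i, j) \<in> P" "j < m" "m - j = h"
    and m': "(i', br j) \<in> mains A" and jm: "j < br m \<or> j = br m \<and> t \<noteq> TypeC"
  shows "entry (act w A) i j = entry (act v A) i j"
proof -
  let ?B = "act w A" and ?C = "act v A"
  have b: "i \<in> idx" "m \<in> idx" "j \<in> idx" "i < j" "i' \<in> idx"
    using P_bounds[OF mains_P[OF m]] P_bounds[OF ij(1)] P_bounds[OF mains_P[OF m']] by auto
  have bj: "br (br j) = j" by (rule br_br[OF b(3)])
  have "br j < br i' \<or> t = TypeC \<and> br j = br i'"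
    using mains_P[OF m'] P_iff[OF b(5) br_in[OF b(3)]] by simp
  then have i'j: "i' < j \<or> t = TypeC \<and> i' = j"
    unfolding br_less[OF b(3,5)] br_inj[OF b(3,5)] by blast
  \<comment> \<open>In type C the main condition in column \<open>br j\<close> may lie on the
    antidiagonal, with i' = j. There \<open>jm\<close> is strict, which saves the
    inequality.\<close>
  then have i'm: "i' < br m" using jm by auto
  have F: "(\<Sum>k\<in>{j..m}. sg k * entry (act u A) i k * entry (act u A) i' (br k))
    = (\<Sum>l\<in>idx. sg l * entry A i l * entry A i' (br l))" if "u \<in> U" for u
    using form_invariant[OF A that m m'] i'm b(4) unfolding bj by simp
  let ?f = "\<lambda>u k. sg k * entry (act u A) i k * entry (act u A) i' (br k)"
  have split: "(\<Sum>k\<in>{j..m}. ?f u k) = ?f u j + ?f u m + (\<Sum>k\<in>{j<..<m}. ?f u k)" for u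
  proof -
    have "{j..m} = insert j (insert m {j<..<m})" using ij(2) by auto
    then show ?thesis using ij(2) by (simp add: add.assoc)
  qed
  \<comment> \<open>Strictly inside the window both factors are nearer to their main conditions than
    h, by k - j and m - k respectively, so \<open>IH\<close> applies to each.\<close>
  have inner: "(\<Sum>k\<in>{j<..<m}. ?f w k) = (\<Sum>k\<in>{j<..<m}. ?f v k)"
  proof (intro sum.cong refl)
    fix k assume k: "k \<in> {j<..<m}"
    have ki: "k \<in> idx" using k b by (auto simp: in_idx)
    have h: "m - k < h" using k ij(3) by auto
    have e1: "entry ?B i k = entry ?C i k"
    proof (rule IH[OF m _ _ h])
      show "(i, k) \<in> P" by (rule P_left[OF mains_P[OF m]]) (use k b in auto)
    qed (use k in auto)
    have d: "br j - br k = k - j" "br k \<le> br j" "br m < br k"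
      using b ki k by (auto simp: bar_def in_idx)
    have e2: "entry ?B i' (br k) = entry ?C i' (br k)"
    proof (rule IH[OF m'])
      show "(i', br k) \<in> P" by (rule P_left[OF mains_P[OF m']]) (use d i'm in auto)
      show "br j - br k < h" unfolding d(1) using k ij(3) by auto
    qed (rule d(2))
    show "?f w k = ?f v k" unfolding e1 e2 ..
  qed
  have eq: "?f w j + ?f w m = ?f v j + ?f v m"
    by (rule add_right_imp_eq[OF trans[OF F[OF w, unfolded split inner] F[OF v, unfolded split, symmetric]]])
  have Bj: "entry ?B i' (br j) = entry A i' (br j)" "entry ?C i' (br j) = entry A i' (br j)"
    by (rule entry_act_main[OF A w m'], rule entry_act_main[OF A v m'])
  have Bm: "entry ?B i m = entry A i m" "entry ?C i m = entry A i m"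
    by (rule entry_act_main[OF A w m], rule entry_act_main[OF A v m])
  have nz: "entry A i' (br j) \<noteq> 0" "entry A i m \<noteq> 0" "sg j \<noteq> 0"
    using mains_nonzero[OF m'] mains_nonzero[OF m] by (simp_all add: sg_def)
  from jm show ?thesis
  proof
    assume jm: "j < br m"
    have "br m \<le> br j" using ij(2) by (auto simp: bar_def)
    have "(i', br m) \<in> P"
      by (rule P_left[OF mains_P[OF m'] i'm \<open>br m \<le> br j\<close>])
    moreover have "br m < br j" using br_less[OF b(2,3)] ij(2) by simp
    \<comment> \<open>In row i' the main column is \<open>br j\<close>, so a core position here
      would need \<open>br m\<close> \<le> j, against \<open>jm\<close>.\<close>
    ultimately have "(i', br m) \<in> places t n A"
      unfolding place_iff[OF m'] bj using jm by auto
    then have "entry ?B i' (br m) = entry ?C i' (br m)" by (rule pl)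
    then have "sg j * entry ?B i j * entry A i' (br j) = sg j * entry ?C i j * entry A i' (br j)"
      using eq unfolding Bj Bm by simp
    then show ?thesis using nz by simp
  next
    assume jm: "j = br m \<and> t \<noteq> TypeC"
    have e: "br j = m" using jm br_br[OF b(2)] by simp
    have "i' = i" using staircaseD[OF st m'[unfolded e] m] .
    moreover have "sg k = 1" for k unfolding sg_def using jm by simp
    moreover have "br m = j" using jm by simp
    \<comment> \<open>Both rows are the same and the two end terms of the window coincide, so the
      wanted entry appears with coefficient twice the main value.\<close>
    ultimately have "entry ?B i j * entry A i m + entry A i m * entry ?B i j
        = entry ?C i j * entry A i m + entry A i m * entry ?C i j"
      using eq Bm unfolding e by simp
    then have "2 * entry A i m * entry ?B i j = 2 * entry A i m * entry ?C i j"
      by (simp add: algebra_simps)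
    then show ?thesis using nz two_nonzero by simp
  qed
qed

lemma places_determine:
  assumes A: "A \<in> V" and st: "staircase t n A" and w: "w \<in> U" and v: "v \<in> U"
    and pl: "\<And>i j. (i, j) \<in> places t n A \<Longrightarrow> entry (act w A) i j = entry (act v A) i j"
  shows "act w A = act v A"
proof -
  have main: "entry (act w A) i j = entry (act v A) i j"
    if "(i, m) \<in> mains A" "(i, j) \<in> P" "j \<le> m" "m - j = h" for i m j h
    using that
  proof (induction h arbitrary: i m j rule: less_induct)
    case (less h)
    show ?case
    proof (cases "j = m")
      case True
      then show ?thesis
        using entry_act_main[OF A w less.prems(1)] entry_act_main[OF A v less.prems(1)] by simp
    next
      case False
      then have jm: "j < m" using less.prems(3) by simp
      show ?thesis
      proof (cases "(i, j) \<in> places t n A")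
        case True
        then show ?thesis by (rule pl)
      next
        case False
        then obtain i' where "(i', br j) \<in> mains A" "j < br m \<or> j = br m \<and> t \<noteq> TypeC"
          unfolding place_iff[OF less.prems(1)] using jm less.prems(2) by blast
        then show ?thesis
          by (intro core_entry_determined[OF A st w v pl less.IH less.prems(1,2) jm less.prems(4)])
            simp_all
      qed
    qed
  qed
  show ?thesis
  proof (rule V_eqI[OF act_in_V act_in_V])
    fix i j assume ij: "(i, j) \<in> P"
    then have b: "i \<in> idx" "j \<in> idx" using P_bounds by auto
    show "entry (act w A) i j = entry (act v A) i j"
    proof (cases "\<exists>m. (i, m) \<in> mains A \<and> j \<le> m")
      case True
      then show ?thesis using main ij by blast
    next
      \<comment> \<open>Right of a main condition, and in rows without one, every matrix of the
        orbit vanishes.\<close>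
      case False
      have "entry (act u A) i j = 0" if "u \<in> U" for u
        using mains_exists[OF act_in_V b, of u A] False mains_act[OF A that] by auto
      then show ?thesis using w v by simp
    qed
  qed
qed

end

subsection \<open>Places and limbs\<close>

context classical_group
begin

section \<open>Mirrored positions\<close>

lemma P_or_bar:
  assumes "a \<in> idx" "b \<in> idx" "a < b" "b \<noteq> br a \<or> t = TypeC" "(a, b) \<notin> P"
  shows "(br b, br a) \<in> P"
proof -
  have "br a < b" using assms P_iff[OF assms(1,2)] by auto
  moreover have "br b < br a" using br_less[OF assms(2,1)] assms(3) by simp
  ultimately show ?thesis
    using P_iff[OF br_in[OF assms(2)] br_in[OF assms(1)]] br_br[OF assms(2)] by simp
qed

lemma P_le_bar: "(a, b) \<in> P \<Longrightarrow> b \<le> br a"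
  by (auto simp: Pset_def split: if_splits)

lemma P_bar_le: "(a, b) \<in> P \<Longrightarrow> a \<le> br b"
  unfolding Pset_def bar_def by (auto split: if_splits)

lemma P_and_bar: "(a, b) \<in> P \<Longrightarrow> (br b, br a) \<in> P \<Longrightarrow> b = br a"
  using P_le_bar[of a b] P_le_bar[of "br b" "br a"] br_br[of b] P_bounds[of a b] by simp

text \<open>The positions at which \<open>w\<close> has to vanish in order to fix \<open>verge A\<close>.\<close>
definition shadow :: "'a mat \<Rightarrow> (nat \<times> nat) set" where
  "shadow A = {(j, m). \<exists>i. (i, m) \<in> mains A \<and> i < j \<and> j < m}"

text \<open>Legs lie in the shadow itself. The mirror image of (\<open>br j\<close>, a) is
  (\<open>br a\<close>, j), so arms are the reflected part of the shadow. For j =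
  \<open>br i\<close> in type C the arm is the rest of row i: the bound a < \<open>br i\<close>
  leaves out the main condition, as i < \<open>br a\<close> does in the shadow.\<close>

lemma Limb_iff:
  assumes ab: "a \<in> idx" "b \<in> idx"
  shows "(a, b) \<in> Limb t n A \<longleftrightarrow> (a, b) \<in> P \<and> ((a, b) \<in> shadow A \<or> (br b, br a) \<in> shadow A)"
proof
  assume "(a, b) \<in> Limb t n A"
  then obtain i j where m: "(i, j) \<in> mains A"
    and l: "(a, b) \<in> leg t n i j \<or> (a, b) \<in> arm t n i j" by (auto simp: Limb_def)
  have ij: "(i, j) \<in> P" by (rule mains_P[OF m])
  have ji: "i \<in> idx" "j \<in> idx" "i < j" using P_bounds[OF ij] by auto
  from l show "(a, b) \<in> P \<and> ((a, b) \<in> shadow A \<or> (br b, br a) \<in> shadow A)"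
  proof
    assume l: "(a, b) \<in> leg t n i j"
    then have "(a, b) \<in> P" "b = j" "i < a" by (auto simp: leg_def)
    moreover have "a < b" using P_bounds[OF \<open>(a, b) \<in> P\<close>] by simp
    ultimately show ?thesis using m by (auto simp: shadow_def)
  next
    assume l: "(a, b) \<in> arm t n i j"
    show ?thesis
    proof (cases "t = TypeC \<and> j = br i")
      case True
      then have e: "a = i" "i < b" "b < br i" using l by (auto simp: arm_def)
      have "(a, b) \<in> P" using e P_iff[OF ab] by simp
      moreover have "i < br b" using e(3) ab(2) ji(1) by (auto simp: bar_def in_idx)
      moreover have "br b < br a" using br_less[OF ab(2,1)] e by simp
      moreover have "(i, br a) \<in> mains A" using m True e(1) by simp
      ultimately show ?thesis unfolding shadow_def by blast
    next
      case False
      then have "arm t n i j = {(r, a) \<in> P. r = br j}" unfolding arm_def by (rule if_not_P)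
      then have e: "(a, b) \<in> P" "a = br j" using l by auto
      have "j < br i" using False ij P_iff[OF ji(1,2)] by blast
      then have "i < br j" using ji by (auto simp: bar_def in_idx)
      then have "i < br b" using P_bar_le[OF e(1)] e(2) by simp
      moreover have "br b < br a" using br_less[OF ab(2,1)] P_bounds[OF e(1)] by simp
      moreover have "br a = j" using e(2) br_br[OF ji(2)] by simp
      ultimately show ?thesis using m e(1) unfolding shadow_def by blast
    qed
  qed
next
  assume h: "(a, b) \<in> P \<and> ((a, b) \<in> shadow A \<or> (br b, br a) \<in> shadow A)"
  then have P: "(a, b) \<in> P" by blast
  have lt: "a < b" using P_bounds[OF P] by simp
  from h[THEN conjunct2] show "(a, b) \<in> Limb t n A"
  proof
    assume "(a, b) \<in> shadow A"
    then obtain i where i: "(i, b) \<in> mains A" "i < a" by (auto simp: shadow_def)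
    then have "(a, b) \<in> leg t n i b" using P by (simp add: leg_def)
    then show ?thesis using i unfolding Limb_def by blast
  next
    assume "(br b, br a) \<in> shadow A"
    then obtain i where i: "(i, br a) \<in> mains A" "i < br b" by (auto simp: shadow_def)
    have ii: "i \<in> idx" using P_bounds[OF mains_P[OF i(1)]] by simp
    have "(a, b) \<in> arm t n i (br a)"
    proof (cases "t = TypeC \<and> br a = br i")
      case True
      then have "a = i" using br_inj[OF ab(1) ii] by simp
      moreover have "b < br i" using i(2) ii ab(2) by (auto simp: bar_def in_idx)
      ultimately show ?thesis using True lt unfolding arm_def by simp
    next
      case False
      then have "arm t n i (br a) = {(r, c) \<in> P. r = br (br a)}" unfolding arm_def by (rule if_not_P)
      then show ?thesis using P br_br[OF ab(1)] by simp
    qed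
    then show ?thesis using i unfolding Limb_def by blast
  qed
qed

lemma Limb_subset_P: "Limb t n A \<subseteq> P"
proof
  fix x assume "x \<in> Limb t n A"
  then obtain i j where m: "(i, j) \<in> mains A"
    and l: "x \<in> leg t n i j \<or> x \<in> arm t n i j" by (auto simp: Limb_def)
  have ij: "(i, j) \<in> P" by (rule mains_P[OF m])
  from l show "x \<in> P"
  proof
    assume "x \<in> leg t n i j" then show ?thesis by (auto simp: leg_def)
  next
    assume l: "x \<in> arm t n i j"
    show ?thesis
    proof (cases "t = TypeC \<and> j = br i")
      case True
      obtain a where "x = (i, a)" "i < a" "a < br i" using l True by (auto simp: arm_def)
      then show ?thesis using P_bounds[OF ij] by (auto simp: Pset_def in_idx)
    next
      case False
      then have "arm t n i j = {(r, a) \<in> P. r = br j}" unfolding arm_def by (rule if_not_P)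
      then show ?thesis using l by auto
    qed
  qed
qed

section \<open>The bijection between places and limb positions\<close>

definition limb_of :: "'a mat \<Rightarrow> nat \<times> nat \<Rightarrow> nat \<times> nat" where
  "limb_of A = (\<lambda>(i, j). if (j, mcol A i) \<in> P then (j, mcol A i) else (br (mcol A i), br j))"

lemma limb_of_eq: "(i, m) \<in> mains A \<Longrightarrow>
    limb_of A (i, j) = (if (j, m) \<in> P then (j, m) else (br m, br j))"
  by (simp add: limb_of_def mcol_eq)

text \<open>The map sends the place (i, j) to the position of the root that moves its entry, which
  is (j, m) or its mirror image. Injectivity is therefore \<open>place_collision\<close>.\<close>

lemma bij_betw_limb_of:
  fixes A :: "'a mat"
  assumes st: "staircase t n A"
  shows "bij_betw (limb_of A) (places t n A) (Limb t n A)"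
proof (rule bij_betw_imageI)
  show "inj_on (limb_of A) (places t n A)"
  proof (rule inj_onI)
    fix p q assume p: "p \<in> places t n A" and q: "q \<in> places t n A" and eq: "limb_of A p = limb_of A q"
    obtain i j i' j' where pq: "p = (i, j)" "q = (i', j')" by (cases p, cases q)
    obtain m where m: "(i, m) \<in> mains A" "(i, j) \<in> P" using p[unfolded pq] by (rule placeE) blast
    obtain m' where m': "(i', m') \<in> mains A" "(i', j') \<in> P" using q[unfolded pq] by (rule placeE) blast
    have b: "m \<in> idx" "m' \<in> idx" "j \<in> idx" "j' \<in> idx"
      using P_bounds[OF mains_P[OF m(1)]] P_bounds[OF mains_P[OF m'(1)]]
        P_bounds[OF m(2)] P_bounds[OF m'(2)] by auto
    have "(j', m') = (j, m) \<or> (j', m') = (br m, br j) \<or> (br m', br j') = (j, m)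
        \<or> (br m', br j') = (br m, br j)"
      using eq unfolding pq limb_of_eq[OF m(1)] limb_of_eq[OF m'(1)] by (metis)
    then have "(j', m') = (j, m) \<or> (j', m') = (br m, br j)"
      using br_inj[OF b(2,1)] br_inj[OF b(4,3)] br_br[OF b(2)] br_br[OF b(4)] by (metis prod.inject)
    then show "p = q" using place_collision[OF st m(1) m'(1)] p q unfolding pq by metis
  qed
  show "limb_of A ` places t n A = Limb t n A"
  proof (intro subset_antisym subsetI)
    fix x assume "x \<in> limb_of A ` places t n A"
    then obtain i j where pl: "(i, j) \<in> places t n A" and x: "x = limb_of A (i, j)" by force
    obtain m where m: "(i, m) \<in> mains A" and ij: "(i, j) \<in> P" "j < m" and ne: "m \<noteq> br j \<or> t = TypeC"
      using pl by (rule placeE) blast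
    have b: "j \<in> idx" "m \<in> idx" "i < j" using P_bounds[OF mains_P[OF m]] P_bounds[OF ij(1)] by auto
    have sh: "(j, m) \<in> shadow A" using m b(3) ij(2) by (auto simp: shadow_def)
    show "x \<in> Limb t n A"
    proof (cases "(j, m) \<in> P")
      case True
      then show ?thesis unfolding x limb_of_eq[OF m] using Limb_iff[OF b(1,2), of A] sh by simp
    next
      case False
      have "(br m, br j) \<in> P" by (rule P_or_bar[OF b(1,2) ij(2) ne False])
      then have "(br m, br j) \<in> Limb t n A"
        unfolding Limb_iff[OF br_in[OF b(2)] br_in[OF b(1)]] br_br[OF b(1)] br_br[OF b(2)]
        using sh by blast
      then show ?thesis unfolding x limb_of_eq[OF m] using False by simp
    qed
  next
    fix x assume xL: "x \<in> Limb t n A"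
    obtain a b where x: "x = (a, b)" by (cases x)
    have P: "(a, b) \<in> P" using Limb_subset_P xL x by blast
    have ab: "a \<in> idx" "b \<in> idx" "a < b" using P_bounds[OF P] by auto
    have bb: "br (br a) = a" "br (br b) = b" using br_br ab by auto
    have ba: "br b < br a" using br_less[OF ab(2,1)] ab(3) by simp
    have "(a, b) \<in> shadow A \<or> (br b, br a) \<in> shadow A"
      using xL unfolding x Limb_iff[OF ab(1,2)] by blast
    then show "x \<in> limb_of A ` places t n A"
    proof
      assume "(a, b) \<in> shadow A"
      then obtain i where i: "(i, b) \<in> mains A" "i < a" by (auto simp: shadow_def)
      have ia: "(i, a) \<in> P" by (rule P_left[OF mains_P[OF i(1)]]) (use i ab in auto)
      show ?thesis
      proof (cases "(i, a) \<in> places t n A")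
        case True
        moreover have "limb_of A (i, a) = x" unfolding limb_of_eq[OF i(1)] x using P by simp
        ultimately show ?thesis by (metis image_eqI)
      next
        case False
        \<comment> \<open>The natural preimage (i, a) is core. The test for core positions then
          supplies a main condition (i', \<open>br a\<close>), and (i', \<open>br b\<close>) is a
          place with the mirrored image, because the inequality is reversed in row i'.\<close>
        then obtain i' where i': "(i', br a) \<in> mains A" and c: "a < br b \<or> a = br b \<and> t \<noteq> TypeC"
          unfolding place_iff[OF i(1)] using ia ab(3) by blast
        have nab: "\<not> (a = br b \<and> t \<noteq> TypeC)"
          using TypeC_if_eq_bar[OF P] br_eq_swap[OF ab(2,1)] by metis
        have lt: "a < br b" using c nab by blast
        have i'P: "(i', br a) \<in> P" by (rule mains_P[OF i'])
        have "i' \<le> a" using P_bar_le[OF i'P] bb by simp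
        then have "(i', br b) \<in> P" using P_left[OF i'P, of "br b"] lt ba by simp
        then have "(i', br b) \<in> places t n A"
          unfolding place_iff[OF i'] bb using lt ba by auto
        moreover have "(br b, br a) \<notin> P"
        proof
          assume "(br b, br a) \<in> P"
          then have "b = br a" by (rule P_and_bar[OF P])
          then have "br b = a" using bb by simp
          then show False using lt by simp
        qed
        then have "limb_of A (i', br b) = x" unfolding limb_of_eq[OF i'] x bb by (rule if_not_P)
        ultimately show ?thesis by (metis image_eqI)
      qed
    next
      assume "(br b, br a) \<in> shadow A"
      then obtain i where i: "(i, br a) \<in> mains A" "i < br b" by (auto simp: shadow_def)
      have ib: "(i, br b) \<in> P" by (rule P_left[OF mains_P[OF i(1)]]) (use i ba in auto)
      \<comment> \<open>In this case the natural preimage always works: (a, b) in \<open>P\<close>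
        forces the inequality opposite to that of core positions.\<close>
      have ge: "a \<le> br b" by (rule P_bar_le[OF P])
      have nab: "\<not> (br b = a \<and> t \<noteq> TypeC)"
        using TypeC_if_eq_bar[OF P] br_eq_swap[OF ab(2,1)] by metis
      have "(i, br b) \<in> places t n A"
        unfolding place_iff[OF i(1)] bb using ib ba ge nab by auto
      moreover have "limb_of A (i, br b) = x"
      proof (cases "(br b, br a) \<in> P")
        case True
        then have "b = br a" by (rule P_and_bar[OF P])
        moreover from this have "br b = a" using bb by simp
        ultimately show ?thesis unfolding limb_of_eq[OF i(1)] x bb using True by simp
      next
        case False
        then show ?thesis unfolding limb_of_eq[OF i(1)] x bb by (rule if_not_P)
      qed
      ultimately show ?thesis by (metis image_eqI)
    qed
  qed
qed

lemma card_places_eq_card_Limb: "staircase t n (A :: 'a mat) \<Longrightarrow> card (places t n A) = card (Limb t n A)"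
  by (rule bij_betw_same_card[OF bij_betw_limb_of])

section \<open>The verge\<close>

lemma entry_verge: "i \<in> idx \<Longrightarrow> j \<in> idx \<Longrightarrow>
    entry (verge t n A) i j = (if (i, j) \<in> mains A then entry A i j else 0)"
  by (simp add: verge_def entry_mat1)

lemma verge_in_V: "(verge t n A :: 'a mat) \<in> V"
  unfolding V_iff using mains_P by (auto simp: entry_verge) (simp add: verge_def)

lemma mains_verge: "mains (verge t n A) = mains A"
proof (intro subset_antisym subrelI)
  fix i j assume h: "(i, j) \<in> mains (verge t n A)"
  have "i \<in> idx" "j \<in> idx" using P_bounds[OF mains_P[OF h]] by auto
  then show "(i, j) \<in> mains A" using mains_nonzero[OF h] by (simp add: entry_verge split: if_splits)
next
  fix i j assume h: "(i, j) \<in> mains A"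
  have b: "i \<in> idx" "j \<in> idx" using P_bounds[OF mains_P[OF h]] by auto
  have "entry (verge t n A) i k = 0" if "(i, k) \<in> P" "j < k" for k
  proof -
    have "k \<in> idx" using P_bounds[OF that(1)] by simp
    moreover have "(i, k) \<notin> mains A" using mains_unique[OF h] that(2) by blast
    ultimately show ?thesis by (simp add: entry_verge[OF b(1)])
  qed
  moreover have "entry (verge t n A) i j \<noteq> 0" using h mains_nonzero[OF h] by (simp add: entry_verge[OF b])
  ultimately show "(i, j) \<in> mains (verge t n A)"
    using mains_P[OF h] by (auto simp: main_conds_def)
qed

text \<open>This and the next three lemmas transfer data that depend only on the main conditions,
  both along an orbit and from A to its verge.\<close>

lemma staircase_cong: "mains A = mains B \<Longrightarrow> staircase t n A = staircase t n B"
  by (simp add: staircase_def)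

lemma core_cong: "mains A = mains B \<Longrightarrow> core t n A = core t n B"
  unfolding core_def supp_conds_def minor_conds_def left_main_def right_main_def by (simp only:)

lemma places_cong: "mains A = mains B \<Longrightarrow> places t n A = places t n B"
  using core_cong[of A B] by (simp add: places_def)

lemma Limb_cong: "mains A = mains B \<Longrightarrow> Limb t n A = Limb t n B"
  by (simp add: Limb_def)

end

subsection \<open>The stabilizer of the verge and orbit sizes\<close>

lemma card_image_cong:
  assumes "\<And>x y. x \<in> C \<Longrightarrow> y \<in> C \<Longrightarrow> f x = f y \<longleftrightarrow> g x = g y"
  shows "card (f ` C) = card (g ` C)"
proof (rule bij_betw_same_card)
  show "bij_betw (\<lambda>z. g (inv_into C f z)) (f ` C) (g ` C)"
  proof (rule bij_betw_imageI)
    have e: "g (inv_into C f (f x)) = g x" if "x \<in> C" for x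
    proof -
      have "inv_into C f (f x) \<in> C" "f (inv_into C f (f x)) = f x"
        using that by (auto intro: inv_into_into f_inv_into_f)
      then show ?thesis using assms that by blast
    qed
    show "inj_on (\<lambda>z. g (inv_into C f z)) (f ` C)"
      using assms by (auto intro!: inj_onI simp: e)
    show "(\<lambda>z. g (inv_into C f z)) ` f ` C = g ` C"
      by (auto simp: e image_image)
  qed
qed

text \<open>Orbit-stabilizer with the action abstracted to a map f whose fibres are the right cosets
  of H.\<close>

lemma (in group) card_rcosets_eq_card_image:
  assumes H: "subgroup H G"
    and f: "\<And>x y. x \<in> carrier G \<Longrightarrow> y \<in> carrier G \<Longrightarrow> f x = f y \<longleftrightarrow> x \<otimes> inv y \<in> H"
  shows "card (rcosets H) = card (f ` carrier G)"
proof -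
  have "rcosets H = (\<lambda>x. H #> x) ` carrier G" by (auto simp: RCOSETS_def)
  moreover have "card ((\<lambda>x. H #> x) ` carrier G) = card (f ` carrier G)"
  proof (rule card_image_cong)
    fix x y assume xy: "x \<in> carrier G" "y \<in> carrier G"
    have "H #> x = H #> y \<longleftrightarrow> x \<in> H #> y"
      using repr_independence[OF _ xy(2) H] rcos_self[OF xy(1) H] by metis
    also have "\<dots> \<longleftrightarrow> x \<otimes> inv y \<in> H" by (rule subgroup.rcos_module[OF H is_group xy(2,1)])
    finally show "H #> x = H #> y \<longleftrightarrow> f x = f y" using f[OF xy] by simp
  qed
  ultimately show ?thesis by simp
qed

context classical_group
begin

section \<open>The stabilizer as a set of matrices\<close>

definition verge_stab :: "'a mat \<Rightarrow> 'a mat set" where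
  "verge_stab A = {w \<in> U. act w (verge t n A) = verge t n A}"

text \<open>A row of the verge has at most one nonzero entry, so acting by w just multiplies it into
  column m of w; left of the main condition the result must vanish.\<close>

lemma verge_stab_iff:
  assumes w: "w \<in> U"
  shows "w \<in> verge_stab A \<longleftrightarrow> (\<forall>(j, m) \<in> shadow A. entry w j m = 0)"
proof -
  let ?V = "verge t n A"
  have row: "entry (act w ?V) i j = entry A i m * entry w j m"
    if m: "(i, m) \<in> mains A" and ij: "i \<in> idx" "j \<in> idx" "i < j" for i j m
  proof -
    have mi: "m \<in> idx" using P_bounds[OF mains_P[OF m]] by simp
    have "entry (act w ?V) i j = (\<Sum>k\<in>idx. if k = m then entry A i m * entry w j m else 0)"
      unfolding entry_act[OF verge_in_V w ij]
    proof (intro sum.cong refl)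
      fix k assume k: "k \<in> idx"
      have "(i, k) \<in> mains A \<longleftrightarrow> k = m" using m mains_unique by blast
      then show "entry ?V i k * entry w j k = (if k = m then entry A i m * entry w j m else 0)"
        by (simp add: entry_verge[OF ij(1) k])
    qed
    then show ?thesis using mi by (simp add: sum.delta)
  qed
  show ?thesis
  proof
    assume h: "w \<in> verge_stab A"
    have "entry w j m = 0" if "(j, m) \<in> shadow A" for j m
    proof -
      obtain i where i: "(i, m) \<in> mains A" "i < j" "j < m" using \<open>(j, m) \<in> shadow A\<close>
        by (auto simp: shadow_def)
      have b: "i \<in> idx" "j \<in> idx" using P_bounds[OF mains_P[OF i(1)]] i(2,3) by (auto simp: in_idx)
      have "(i, j) \<notin> mains A" using mains_unique[OF i(1)] i(3) by blast
      then have "entry (act w ?V) i j = 0"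
        using h by (simp add: verge_stab_def entry_verge[OF b])
      then show ?thesis using row[OF i(1) b i(2)] mains_nonzero[OF i(1)] by simp
    qed
    then show "\<forall>(j, m) \<in> shadow A. entry w j m = 0" by blast
  next
    assume h: "\<forall>(j, m) \<in> shadow A. entry w j m = 0"
    have "act w ?V = ?V"
    proof (rule V_eqI[OF act_in_V verge_in_V])
      fix i j assume "(i, j) \<in> P"
      then have b: "i \<in> idx" "j \<in> idx" "i < j" using P_bounds by auto
      show "entry (act w ?V) i j = entry ?V i j"
      proof (cases "\<exists>m. (i, m) \<in> mains A")
        case True
        then obtain m where m: "(i, m) \<in> mains A" by blast
        have mi: "m \<in> idx" using P_bounds[OF mains_P[OF m]] by simp
        have nm: "(i, j) \<in> mains A \<longleftrightarrow> j = m" using m mains_unique by blast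
        consider "j < m" | "j = m" | "m < j" by linarith
        then show ?thesis
        proof cases
          case 1
          then have "entry w j m = 0" using h m b(3) by (auto simp: shadow_def)
          then show ?thesis using 1 nm by (simp add: row[OF m b] entry_verge[OF b(1,2)])
        next
          case 2
          then show ?thesis unfolding row[OF m b] entry_verge[OF b(1,2)]
            using U_diag[OF w b(2)] m by simp
        next
          case 3
          then show ?thesis using nm U_below[OF w b(2) 3 mi]
            by (simp add: row[OF m b] entry_verge[OF b(1,2)])
        qed
      next
        case False
        then have "entry ?V i k = 0" if "k \<in> idx" for k by (simp add: entry_verge[OF b(1) that])
        then show ?thesis using b(2) by (simp add: entry_act[OF verge_in_V w b])
      qed
    qed
    then show "w \<in> verge_stab A" using w by (simp add: verge_stab_def)
  qed
qed

lemma verge_stab_in_U: "w \<in> verge_stab A \<Longrightarrow> w \<in> U"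
  by (simp add: verge_stab_def)

lemma verge_stab_mult: "v \<in> verge_stab A \<Longrightarrow> w \<in> verge_stab A \<Longrightarrow> v * w \<in> verge_stab A"
  using act_act[OF verge_in_V, of w v A] by (simp add: verge_stab_def mult_in_U)

lemma verge_stab_star: "w \<in> verge_stab A \<Longrightarrow> star w \<in> verge_stab A"
  using act_star[OF verge_in_V, of w A] by (simp add: verge_stab_def star_in_U)

lemma verge_stab_subgroup: "subgroup (verge_stab A) (Ugrp t n)"
proof (rule group.subgroupI[OF U_group])
  show "verge_stab A \<subseteq> U" using verge_stab_in_U by blast
  show "verge_stab A \<noteq> {}" using act_one[OF verge_in_V] one_in_U by (auto simp: verge_stab_def)
next
  fix w assume w: "w \<in> verge_stab A"
  show "inv\<^bsub>Ugrp t n\<^esub> w \<in> verge_stab A"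
    unfolding U_inv[OF verge_stab_in_U[OF w]] by (rule verge_stab_star[OF w])
qed (simp add: verge_stab_mult)

text \<open>Legs are immediate. For arms the adjoint of w, being its inverse, is in the stabilizer
  too, and its entries are those of w mirrored up to sign.\<close>

lemma entry_eq_zero_of_Limb:
  assumes w: "w \<in> verge_stab A" and ab: "(a, b) \<in> Limb t n A"
  shows "entry w a b = 0"
proof -
  have P: "(a, b) \<in> P" using ab Limb_subset_P by blast
  have b: "a \<in> idx" "b \<in> idx" using P_bounds[OF P] by auto
  have wU: "w \<in> U" by (rule verge_stab_in_U[OF w])
  from ab have "(a, b) \<in> shadow A \<or> (br b, br a) \<in> shadow A" unfolding Limb_iff[OF b] by blast
  then show ?thesis
  proof
    assume "(a, b) \<in> shadow A"
    then show ?thesis using w verge_stab_iff[OF wU] by blast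
  next
    assume s: "(br b, br a) \<in> shadow A"
    have "star w \<in> verge_stab A" by (rule verge_stab_star[OF w])
    then have "entry (star w) (br b) (br a) = 0" using s verge_stab_iff[OF star_in_U[OF wU]] by blast
    then have "sg (br b) * sg (br a) * entry w a b = 0"
      unfolding entry_star[OF br_in[OF b(2)] br_in[OF b(1)]] br_br[OF b(1)] br_br[OF b(2)] .
    moreover have "sg (br b) \<noteq> 0" "sg (br a) \<noteq> 0" by (simp_all add: sg_def)
    ultimately show ?thesis by simp
  qed
qed

lemma root_elt_in_verge_stab:
  assumes J: "(a, b) \<in> Jset t n A"
  shows "root_elt t n a b \<alpha> \<in> verge_stab A"
proof -
  have P: "(a, b) \<in> P" and nL: "(a, b) \<notin> Limb t n A" using J by (auto simp: Jset_def)
  have b: "a \<in> idx" "b \<in> idx" "a < b" using P_bounds[OF P] by auto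
  have ns: "(a, b) \<notin> shadow A" "(br b, br a) \<notin> shadow A"
    using nL P unfolding Limb_iff[OF b(1,2)] by auto
  \<comment> \<open>The quadratic entry of type B sits in the same column as the mirrored entry but
    in a higher row. If its position were in the shadow, so would be the mirrored one.\<close>
  have nd: "(a, br a) \<notin> shadow A" if e: "b = br b"
  proof
    assume "(a, br a) \<in> shadow A"
    then obtain i where i: "(i, br a) \<in> mains A" "i < a" by (auto simp: shadow_def)
    have "i < br b" using i(2) b(3) e by simp
    moreover have "br b < br a" using br_less[OF b(2,1)] b(3) by simp
    ultimately have "(br b, br a) \<in> shadow A" using i(1) unfolding shadow_def by blast
    then show False using ns by blast
  qed
  have "entry (root_elt t n a b \<alpha>) j m = 0" if s: "(j, m) \<in> shadow A" for j m
  proof -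
    obtain i where i: "(i, m) \<in> mains A" "i < j" "j < m" using s by (auto simp: shadow_def)
    have jm: "j \<in> idx" "m \<in> idx" using P_bounds[OF mains_P[OF i(1)]] i(2,3) by (auto simp: in_idx)
    have "\<not> (j = a \<and> m = b)" "\<not> (j = br b \<and> m = br a)" "\<not> (j = a \<and> m = br a \<and> b = br b)" "j \<noteq> m"
      using s ns nd i(3) by auto
    then show ?thesis unfolding entry_root_elt[OF P jm] rt_def by auto
  qed
  then show ?thesis unfolding verge_stab_iff[OF root_elt_in_U[OF P]] by blast
qed

section \<open>Generating the stabilizer by root elements\<close>

lemma UJ_gens_subset: "(\<Union>(i, j) \<in> Jset t n A. root_subgroup t n i j) \<subseteq> verge_stab A"
  using root_elt_in_verge_stab by (auto simp: root_subgroup_def)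

lemma UJ_subset: "UJ t n A \<subseteq> verge_stab A"
  unfolding UJ_def
  by (rule group.generate_subgroup_incl[OF U_group UJ_gens_subset verge_stab_subgroup])

lemma UJ_subgroup: "subgroup (UJ t n A) (Ugrp t n :: 'a mat monoid)"
  unfolding UJ_def
  by (rule group.generate_is_subgroup[OF U_group])
    (use UJ_gens_subset verge_stab_in_U in blast)

lemma UJ_mult: "v \<in> UJ t n A \<Longrightarrow> w \<in> UJ t n A \<Longrightarrow> v * w \<in> UJ t n (A :: 'a mat)"
  using subgroup.m_closed[OF UJ_subgroup] by simp

text \<open>By induction on the height, entry (l, k) of w (\<open>star w\<close>) = 1 retains only
  the two end terms: the entry of w there and, up to sign, its mirror image. Off \<open>P\<close>
  the mirror image lies in \<open>P\<close>, or the position is antidiagonal outside type C.\<close>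

lemma U_eq_oneI:
  assumes w: "w \<in> U" and z: "\<And>a b. (a, b) \<in> P \<Longrightarrow> entry w a b = 0"
  shows "w = 1\<^sub>m N"
proof -
  have wt: "w \<in> Utilde t n" "star w \<in> Utilde t n" using w star_in_U[OF w] U_iff by auto
  have main: "entry w l k = 0" if "l \<in> idx" "k \<in> idx" "l < k" "k - l = h" for l k h
    using that
  proof (induction h arbitrary: l k rule: less_induct)
    case (less h)
    have lk: "l \<in> idx" "k \<in> idx" "l < k" by fact+
    show ?case
    proof (cases "(l, k) \<in> P")
      case False
      have "entry (w * star w) l k = (\<Sum>c\<in>{l..k}. entry w l c * entry (star w) c k)"
        by (rule entry_mult_U[OF wt lk(1,2)])
      also have "\<dots> = (\<Sum>c\<in>{l, k}. entry w l c * entry (star w) c k)"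
      proof (rule sum.mono_neutral_right, rule_tac [3] ballI)
        fix c assume c: "c \<in> {l..k} - {l, k}"
        have "entry w l c = 0"
          by (rule less.IH[of "c - l"]) (use c lk less.prems(4) in \<open>auto simp: in_idx\<close>)
        then show "entry w l c * entry (star w) c k = 0" by simp
      qed (use lk in auto)
      also have "\<dots> = entry (star w) l k + entry w l k"
        using lk U_diag[OF w lk(1)] U_diag[OF star_in_U[OF w] lk(2)] by simp
      finally have sum: "entry (star w) l k + entry w l k = 0"
        using lk by (simp add: star_right[OF w] entry_one)
      have st: "entry (star w) l k = sg l * sg k * entry w (br k) (br l)"
        by (rule entry_star[OF lk(1,2)])
      show ?thesis
      proof (cases "k \<noteq> br l \<or> t = TypeC")
        case True
        then have "(br k, br l) \<in> P" by (rule P_or_bar[OF lk _ False])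
        then show ?thesis using sum st z by simp
      next
        case c: False
        \<comment> \<open>The entry is its own mirror image and all signs are 1, so it occurs
          twice.\<close>
        then have kl: "br l = k" "br k = l" using br_br[OF lk(1)] by auto
        have "sg i = 1" for i unfolding sg_def using c by simp
        then have "2 * entry w l k = 0" using sum unfolding st kl by simp
        then show ?thesis using two_nonzero by simp
      qed
    qed (rule z)
  qed
  show ?thesis
  proof (rule mat_eq_entryI[OF U_mat[OF w]])
    fix i j assume ij: "i \<in> idx" "j \<in> idx"
    consider "i < j" | "i = j" | "j < i" by linarith
    then show "entry w i j = entry (1\<^sub>m N) i j"
      unfolding entry_one[OF ij]
      by cases (simp_all add: main ij U_diag[OF w] U_below[OF w])
  qed simp
qed

lemma verge_stab_reduce:
  assumes w: "w \<in> verge_stab A" and T: "finite T" "T \<subseteq> P"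
  shows "\<exists>u \<in> UJ t n A. \<forall>(a, b) \<in> T. entry (u * w) a b = 0"
  using T
proof (induction rule: finite_ranking_induct[where f = "\<lambda>(a, b). b - a"])
  case empty
  then show ?case using subgroup.one_closed[OF UJ_subgroup, of A] by auto
next
  case (insert p T)
  obtain a b where p: "p = (a, b)" by (cases p)
  have P: "(a, b) \<in> P" using insert.prems p by simp
  have ab: "a \<in> idx" "b \<in> idx" "a < b" using P_bounds[OF P] by auto
  obtain u where u: "u \<in> UJ t n A" and z: "\<And>l k. (l, k) \<in> T \<Longrightarrow> entry (u * w) l k = 0"
    using insert by blast
  let ?v = "u * w"
  have v: "?v \<in> verge_stab A" by (rule verge_stab_mult[OF _ w]) (use u UJ_subset in blast)
  have vU: "?v \<in> U" by (rule verge_stab_in_U[OF v])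
  show ?case
  proof (cases "entry ?v a b = 0")
    case True
    then show ?thesis using u z p by (intro bexI[of _ u]) auto
  next
    case False
    \<comment> \<open>Elements of the stabilizer vanish on the limb, so the root element needed for
      clearing always belongs to a position of \<open>Jset\<close>.\<close>
    then have "(a, b) \<notin> Limb t n A" using entry_eq_zero_of_Limb[OF v] by blast
    then have J: "(a, b) \<in> Jset t n A" using P by (simp add: Jset_def)
    define x where "x = root_elt t n a b (- entry ?v a b)"
    have xU: "x \<in> U" unfolding x_def by (rule root_elt_in_U[OF P])
    have "x \<in> (\<Union>(i, j) \<in> Jset t n A. root_subgroup t n i j)"
      using J unfolding x_def root_subgroup_def by blast
    then have xJ: "x \<in> UJ t n A" unfolding UJ_def by (rule generate.incl)
    have low: "(l, c) = (a, b) \<or> (l, c) = (br b, br a)"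
      if "l \<in> idx" "c \<in> idx" "l < c" "c - l \<le> b - a" "entry x l c \<noteq> 0" for l c
      by (rule root_elt_low_support[OF P that(1-4) that(5)[unfolded x_def]])
    have Ut: "x \<in> Utilde t n" "?v \<in> Utilde t n" using xU vU U_iff by auto
    \<comment> \<open>Among positions of \<open>P\<close> of height at most b - a, multiplying by x
      changes only (a, b): its other low entry is the mirror image, which lies in \<open>P\<close>
      only if it is (a, b) itself.\<close>
    have val: "entry (x * ?v) l k = entry ?v l k + (if (l, k) = (a, b) then - entry ?v a b else 0)"
      if lk: "(l, k) \<in> P" "k - l \<le> b - a" for l k
    proof -
      have b: "l \<in> idx" "k \<in> idx" "l < k" using P_bounds[OF lk(1)] by auto
      have only: "c = k \<and> (l, k) = (a, b)" if c: "c \<in> {l<..k}" "entry x l c \<noteq> 0" for c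
      proof -
        have ci: "c \<in> idx" using c b by (auto simp: in_idx)
        have "(l, c) = (a, b) \<or> (l, c) = (br b, br a)"
          using low[OF b(1) ci _ _ c(2)] c(1) lk(2) by auto
        moreover have d: "br a - br b = b - a" using ab by (auto simp: bar_def in_idx)
        ultimately have "c - l = b - a" by auto
        then have ck: "c = k" using c(1) lk(2) by auto
        from \<open>(l, c) = (a, b) \<or> (l, c) = (br b, br a)\<close> show ?thesis
        proof
          assume "(l, c) = (a, b)" then show ?thesis using ck by simp
        next
          assume e: "(l, c) = (br b, br a)"
          then have "(br b, br a) \<in> P" using lk(1) ck by simp
          then have "b = br a" by (rule P_and_bar[OF P])
          moreover from this have "br b = a" using br_br[OF ab(1)] by simp
          ultimately show ?thesis using e ck by simp
        qed
      qed
      have "entry (x * ?v) l k = (\<Sum>c\<in>{l..k}. entry x l c * entry ?v c k)"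
        by (rule entry_mult_U[OF Ut b(1,2)])
      also have "\<dots> = entry x l l * entry ?v l k + (\<Sum>c\<in>{l<..k}. entry x l c * entry ?v c k)"
        using b(3) by (subst sum.head) auto
      also have "(\<Sum>c\<in>{l<..k}. entry x l c * entry ?v c k)
          = (if (l, k) = (a, b) then - entry ?v a b else 0)"
      proof (cases "(l, k) = (a, b)")
        case True
        have "(\<Sum>c\<in>{l<..k}. entry x l c * entry ?v c k) = (\<Sum>c\<in>{k}. entry x l c * entry ?v c k)"
        proof (rule sum.mono_neutral_right, rule_tac [3] ballI)
          fix c assume c: "c \<in> {l<..k} - {k}"
          have "entry x l c = 0" using only[of c] c by blast
          then show "entry x l c * entry ?v c k = 0" by simp
        qed (use b(3) in auto)
        also have "\<dots> = - entry ?v a b"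
          using True U_diag[OF vU b(2)] by (simp add: x_def root_elt_entry_self[OF P])
        finally show ?thesis using True by simp
      next
        case False
        have "(\<Sum>c\<in>{l<..k}. entry x l c * entry ?v c k) = 0"
        proof (intro sum.neutral ballI)
          fix c assume c: "c \<in> {l<..k}"
          have "entry x l c = 0" using only[OF c] False by blast
          then show "entry x l c * entry ?v c k = 0" by simp
        qed
        then show ?thesis unfolding if_not_P[OF False] .
      qed
      finally show ?thesis using U_diag[OF xU b(1)] by simp
    qed
    have uU: "u \<in> U" using u UJ_subset verge_stab_in_U by blast
    have assoc: "x * ?v = (x * u) * w"
      using assoc_mult_N[OF U_mat[OF xU] U_mat[OF uU] U_mat[OF verge_stab_in_U[OF w]]] by simp
    have "entry ((x * u) * w) l k = 0" if lk: "(l, k) \<in> insert p T" for l k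
    proof (cases "(l, k) = (a, b)")
      case True
      then show ?thesis using val[OF P] unfolding assoc by simp
    next
      case False
      then have T: "(l, k) \<in> T" using lk p by auto
      then have "k - l \<le> b - a" using insert.hyps(2)[OF T] p by simp
      moreover have "(l, k) \<in> P" using T insert.prems by blast
      ultimately show ?thesis using val[of l k] z[OF T] unfolding if_not_P[OF False] assoc by simp
    qed
    then show ?thesis using UJ_mult[OF xJ u] by (intro bexI[of _ "x * u"]) auto
  qed
qed

lemma UJ_eq_verge_stab: "UJ t n A = verge_stab A"
proof (rule antisym[OF UJ_subset subsetI])
  fix w assume w: "w \<in> verge_stab A"
  then have wU: "w \<in> U" by (rule verge_stab_in_U)
  obtain u where u: "u \<in> UJ t n A" and z: "\<And>a b. (a, b) \<in> P \<Longrightarrow> entry (u * w) a b = 0"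
    using verge_stab_reduce[OF w finite_P subset_refl] by blast
  have uU: "u \<in> U" using u UJ_subset verge_stab_in_U by blast
  have "u * w = 1\<^sub>m N" by (rule U_eq_oneI[OF mult_in_U[OF uU wU] z])
  then have "star u * (u * w) = star u" by (simp only: right_mult_one_mat[OF star_carrier])
  moreover have "star u * (u * w) = (star u * u) * w"
    using assoc_mult_N[OF star_carrier U_mat[OF uU] U_mat[OF wU]] by simp
  ultimately have "w = star u" using U_mat[OF wU] by (simp add: star_left[OF uU])
  then show "w \<in> UJ t n A"
    using subgroup.m_inv_closed[OF UJ_subgroup u] by (simp add: U_inv[OF uU])
qed

section \<open>Orbits of matrices and their sizes\<close>

definition orb :: "'a mat \<Rightarrow> 'a mat set" where
  "orb A = (\<lambda>w. act w A) ` U"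

lemma orbE: assumes "B \<in> orb A" obtains w where "w \<in> U" "B = act w A"
  using assms by (auto simp: orb_def)

lemma orb_in_V: "B \<in> orb A \<Longrightarrow> B \<in> V"
  by (auto simp: orb_def act_in_V)

lemma orb_places_ex1:
  assumes A: "A \<in> V" and st: "staircase t n A"
  shows "\<exists>!B. B \<in> orb A \<and> (\<forall>(i, j) \<in> places t n A. entry B i j = \<Lambda> (i, j))"
proof -
  have fin: "finite (places t n A)"
    by (rule finite_subset[OF _ finite_P]) (auto simp: places_def)
  obtain w where "w \<in> U" "\<forall>(i, j) \<in> places t n A. entry (act w A) i j = \<Lambda> (i, j)"
    using places_solvable[OF A st fin subset_refl, of \<Lambda>] by blast
  moreover have "B = C" if B: "B \<in> orb A" "\<forall>(i, j) \<in> places t n A. entry B i j = \<Lambda> (i, j)"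
    and C: "C \<in> orb A" "\<forall>(i, j) \<in> places t n A. entry C i j = \<Lambda> (i, j)" for B C
  proof -
    obtain v where v: "v \<in> U" "B = act v A" using B(1) by (rule orbE)
    obtain u where u: "u \<in> U" "C = act u A" using C(1) by (rule orbE)
    show ?thesis unfolding v(2) u(2)
      by (rule places_determine[OF A st v(1) u(1)]) (use B(2) C(2) v(2) u(2) in fastforce)
  qed
  ultimately show ?thesis unfolding orb_def by blast
qed

lemma card_orb:
  assumes A: "A \<in> V" and st: "staircase t n A"
  shows "card (orb A) = card (UNIV :: 'a set) ^ card (places t n A)"
proof -
  have fin: "finite (places t n A)"
    by (rule finite_subset[OF _ finite_P]) (auto simp: places_def)
  let ?r = "\<lambda>B. \<lambda>p \<in> places t n A. entry B (fst p) (snd p)"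
  have "bij_betw ?r (orb A) (places t n A \<rightarrow>\<^sub>E UNIV)"
  proof (rule bij_betw_imageI)
    show "inj_on ?r (orb A)"
    proof (rule inj_onI)
      fix B C assume B: "B \<in> orb A" and C: "C \<in> orb A" and eq: "?r B = ?r C"
      have "entry B i j = entry C i j" if "(i, j) \<in> places t n A" for i j
        using fun_cong[OF eq, of "(i, j)"] that by simp
      then have "\<forall>(i, j) \<in> places t n A. entry B i j = entry C i j" by blast
      then show "B = C"
        using orb_places_ex1[OF A st, of "\<lambda>(i, j). entry C i j"] B C by auto
    qed
    show "?r ` orb A = (places t n A \<rightarrow>\<^sub>E UNIV)"
    proof (intro subset_antisym subsetI)
      fix \<Lambda> :: "nat \<times> nat \<Rightarrow> 'a" assume L: "\<Lambda> \<in> places t n A \<rightarrow>\<^sub>E UNIV"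
      obtain B where B: "B \<in> orb A" "\<forall>(i, j) \<in> places t n A. entry B i j = \<Lambda> (i, j)"
        using orb_places_ex1[OF A st, of \<Lambda>] by blast
      have "?r B = \<Lambda>" using B(2) L by (fastforce simp: restrict_def PiE_def extensional_def)
      then show "\<Lambda> \<in> ?r ` orb A" using B(1) by blast
    qed auto
  qed
  then have "card (orb A) = card (places t n A \<rightarrow>\<^sub>E (UNIV :: 'a set))" by (rule bij_betw_same_card)
  then show ?thesis using fin by (simp add: card_PiE)
qed

text \<open>Taking adjoints permutes \<open>U\<close>.\<close>

lemma orb_star: "orb A = (\<lambda>w. act (star w) A) ` U"
  unfolding orb_def using star_in_U star_star[OF U_mat] by (force simp: image_iff)

text \<open>For the left action \<open>act\<close> the fibres of w \<mapsto> \<open>act w\<close>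
  are left cosets of the stabilizer. Passing to \<open>star\<close> turns them into the right cosets
  being counted.\<close>

lemma card_rcosets_UJ: "card (rcosets\<^bsub>Ugrp t n\<^esub> (UJ t n A)) = card (orb (verge t n A))"
  unfolding orb_star
proof (rule group.card_rcosets_eq_card_image[OF U_group UJ_subgroup])
  fix x y assume x: "x \<in> U" and y: "y \<in> U"
  let ?V = "verge t n A"
  have "act (star x) ?V = act (star y) ?V \<longleftrightarrow> act (x * star y) ?V = ?V"
  proof
    assume h: "act (star x) ?V = act (star y) ?V"
    have "act (x * star y) ?V = act x (act (star y) ?V)"
      by (rule act_act[OF verge_in_V star_in_U[OF y] x, symmetric])
    also have "\<dots> = act (x * star x) ?V"
      unfolding h[symmetric] by (rule act_act[OF verge_in_V star_in_U[OF x] x])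
    finally show "act (x * star y) ?V = ?V" by (simp add: star_right[OF x] act_one[OF verge_in_V])
  next
    assume h: "act (x * star y) ?V = ?V"
    have "act (star x) ?V = act (star x) (act x (act (star y) ?V))"
      unfolding act_act[OF verge_in_V star_in_U[OF y] x] h ..
    also have "\<dots> = act (star y) ?V" by (rule act_star[OF act_in_V x])
    finally show "act (star x) ?V = act (star y) ?V" .
  qed
  also have "\<dots> \<longleftrightarrow> x \<otimes>\<^bsub>Ugrp t n\<^esub> inv\<^bsub>Ugrp t n\<^esub> y \<in> UJ t n A"
    unfolding UJ_eq_verge_stab verge_stab_def using mult_in_U[OF x star_in_U[OF y]]
    by (simp add: U_inv[OF y])
  finally show "act (star x) ?V = act (star y) ?V
    \<longleftrightarrow> x \<otimes>\<^bsub>Ugrp t n\<^esub> inv\<^bsub>Ugrp t n\<^esub> y \<in> UJ t n A" .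
qed

end

subsection \<open>Characters\<close>

context classical_group
begin

lemma kappa_smult_munit:
  fixes A :: "'a mat"
  assumes A: "A \<in> carrier_mat N N" and ij: "i \<in> idx" "j \<in> idx"
  shows "kappa A (c \<cdot>\<^sub>m munit t n i j) = c * entry A i j"
proof -
  let ?E = "c \<cdot>\<^sub>m munit t n i j"
  have E: "?E \<in> carrier_mat N N" and T: "A\<^sup>T \<in> carrier_mat N N" using A by auto
  have "kappa A ?E = (\<Sum>l\<in>{..<N}. (A\<^sup>T * ?E) $$ (l, l))"
    using A by (simp add: kappa_def mtrace_def)
  also have "\<dots> = (\<Sum>l\<in>idx. entry (A\<^sup>T * ?E) l l)"
    by (rule sum.reindex_bij_witness[of _ "\<lambda>l. l - 1" Suc]) (auto simp: entry_def in_idx)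
  also have "\<dots> = (\<Sum>l\<in>idx. if l = j then c * entry A i j else 0)"
  proof (intro sum.cong refl)
    fix l assume l: "l \<in> idx"
    have "entry (A\<^sup>T * ?E) l l = (\<Sum>k\<in>idx. if k = i then (if l = j then c * entry A i j else 0) else 0)"
      unfolding entry_mult[OF T E l l]
      by (intro sum.cong refl)
        (auto simp: entry_transpose[OF A] l entry_smult[OF munit_carrier] entry_munit)
    then show "entry (A\<^sup>T * ?E) l l = (if l = j then c * entry A i j else 0)"
      using ij by (simp add: sum.delta)
  qed
  also have "\<dots> = c * entry A i j" using ij by (simp add: sum.delta)
  finally show ?thesis .
qed

text \<open>If A and B differ at (i, j), then on multiples of that matrix unit the two arguments of
  \<theta> differ by an arbitrary field element, which would make \<theta> trivial.\<close>

lemma lchar_inj: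
  assumes th: "nontrivial_additive_character \<theta>" and A: "A \<in> V" and B: "B \<in> V"
    and eq: "lchar t n \<theta> A = lchar t n \<theta> B"
  shows "A = B"
proof (rule V_eqI[OF A B], rule ccontr)
  fix i j assume P: "(i, j) \<in> P" and ne: "entry A i j \<noteq> entry B i j"
  have b: "i \<in> idx" "j \<in> idx" using P_bounds[OF P] by auto
  have add: "\<theta> (x + y) = \<theta> x * \<theta> y" for x y
    using th by (simp add: nontrivial_additive_character_def)
  have nz: "\<theta> x \<noteq> 0" for x
    using add[of x "- x"] th by (auto simp: nontrivial_additive_character_def)
  have "\<theta> x = 1" for x
  proof -
    \<comment> \<open>Chosen so that the two arguments of \<theta> differ exactly by x.\<close>
    define c where "c = - (x / (entry A i j - entry B i j))"
    have E: "c \<cdot>\<^sub>m munit t n i j \<in> V"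
      unfolding V_iff using P by (auto simp: entry_smult[OF munit_carrier] entry_munit)
    have "\<theta> (- kappa A (c \<cdot>\<^sub>m munit t n i j)) = \<theta> (- kappa B (c \<cdot>\<^sub>m munit t n i j))"
      using fun_cong[OF eq, of "c \<cdot>\<^sub>m munit t n i j"] E by (simp add: lchar_def)
    then have "\<theta> (- (c * entry A i j)) = \<theta> (- (c * entry B i j))"
      unfolding kappa_smult_munit[OF V_mat[OF A] b] kappa_smult_munit[OF V_mat[OF B] b] .
    moreover have "- (c * entry A i j) = - (c * entry B i j) + x"
    proof -
      have "c * (entry A i j - entry B i j) = - x" using ne by (simp add: c_def)
      then show ?thesis by (simp add: algebra_simps)
    qed
    ultimately show ?thesis using add[of "- (c * entry B i j)" x] nz[of "- (c * entry B i j)"] by simp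
  qed
  then show False using th by (auto simp: nontrivial_additive_character_def)
qed

lemma orbit_eq: "orbit t n \<theta> A = lchar t n \<theta> ` orb A"
proof -
  have "lchar_act t n \<theta> A u = lchar t n \<theta> (act (star u) A)" if "u \<in> U" for u
    by (simp add: lchar_act_def act_def GL_inv_eq_star[OF that])
  then have "(\<lambda>u. lchar_act t n \<theta> A u) ` U = (\<lambda>u. lchar t n \<theta> (act (star u) A)) ` U"
    by (rule image_cong[OF refl])
  then show ?thesis unfolding orbit_def orb_star image_image by (simp only: Setcompr_eq_image)
qed

lemma has_places_iff:
  assumes th: "nontrivial_additive_character \<theta>"
  shows "has_places t n \<theta> A \<Lambda> B
    \<longleftrightarrow> B \<in> orb A \<and> (\<forall>(i, j) \<in> places t n A. entry B i j = \<Lambda> (i, j))"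
proof -
  have "B \<in> V \<and> lchar t n \<theta> B \<in> orbit t n \<theta> A \<longleftrightarrow> B \<in> orb A"
    unfolding orbit_eq using lchar_inj[OF th] orb_in_V by blast
  then show ?thesis unfolding has_places_def by blast
qed

lemma card_orbit:
  assumes "nontrivial_additive_character \<theta>"
  shows "card (orbit t n \<theta> A) = card (orb A)"
  unfolding orbit_eq
  by (rule card_image, rule inj_onI, rule lchar_inj[OF assms]) (auto dest: orb_in_V)

text \<open>A nonzero entry is at or left of the main condition of its row, where every position is
  either core or a place; core and places are the same for B as for A.\<close>

lemma core_character_iff:
  assumes A: "A \<in> V" and st: "staircase t n A" and B: "B \<in> orb A"
  shows "core_character t n B \<longleftrightarrow> (\<forall>(i, j) \<in> places t n A. entry B i j = 0)"
proof -
  obtain w where w: "w \<in> U" "B = act w A" using B by (rule orbE)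
  have mB: "mains B = mains A" unfolding w(2) by (rule mains_act[OF A w(1)])
  have stB: "staircase t n B" using st staircase_cong[OF mB] by simp
  have c: "core t n B = core t n A" by (rule core_cong[OF mB])
  have BV: "B \<in> V" by (rule orb_in_V[OF B])
  have "core_character t n B \<longleftrightarrow> (\<forall>i\<in>idx. \<forall>j\<in>idx. entry B i j \<noteq> 0 \<longrightarrow> (i, j) \<in> core t n A)"
    unfolding core_character_def c using stB by (auto simp: idx_def)
  also have "\<dots> \<longleftrightarrow> (\<forall>(i, j) \<in> places t n A. entry B i j = 0)"
  proof
    assume h: "\<forall>i\<in>idx. \<forall>j\<in>idx. entry B i j \<noteq> 0 \<longrightarrow> (i, j) \<in> core t n A"
    show "\<forall>(i, j) \<in> places t n A. entry B i j = 0"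
    proof clarify
      fix i j assume "(i, j) \<in> places t n A"
      then have "(i, j) \<in> P" "(i, j) \<notin> core t n A" by (auto simp: places_def)
      then show "entry B i j = 0" using h P_bounds by blast
    qed
  next
    assume h: "\<forall>(i, j) \<in> places t n A. entry B i j = 0"
    show "\<forall>i\<in>idx. \<forall>j\<in>idx. entry B i j \<noteq> 0 \<longrightarrow> (i, j) \<in> core t n A"
    proof (intro ballI impI)
      fix i j assume ij: "i \<in> idx" "j \<in> idx" and nz: "entry B i j \<noteq> 0"
      obtain m where m: "(i, m) \<in> mains A" "j \<le> m"
        using mains_exists[OF BV ij nz] unfolding mB by blast
      have P: "(i, j) \<in> P" using V_outside[OF BV ij] nz by blast
      show "(i, j) \<in> core t n A"
      proof (cases "j = m")
        case True
        then show ?thesis using m(1) unfolding core_def by (split if_split) blast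
      next
        case False
        then have "j < m" using m(2) by simp
        then show ?thesis using h nz P m(1) by (auto simp: places_def)
      qed
    qed
  qed
  finally show ?thesis .
qed

lemma staircase_orbit:
  assumes th: "nontrivial_additive_character \<theta>" and A: "A \<in> V" and st: "staircase t n A"
  shows "\<exists>!B. has_places t n \<theta> A \<Lambda> B"
    and "orbit t n \<theta> A = {lchar t n \<theta> (B_of t n \<theta> A \<Lambda>) | \<Lambda>. \<Lambda> \<in> places t n A \<rightarrow>\<^sub>E (UNIV :: 'a set)}"
    and "{A\<^sub>0 \<in> V. lchar t n \<theta> A\<^sub>0 \<in> orbit t n \<theta> A \<and> core_character t n A\<^sub>0}
      = {B_of t n \<theta> A (\<lambda>_ \<in> places t n A. 0)}"
proof -
  show ex1: "\<exists>!B. has_places t n \<theta> A \<Lambda> B" for \<Lambda>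
    unfolding has_places_iff[OF th] by (rule orb_places_ex1[OF A st])
  have B_of: "has_places t n \<theta> A \<Lambda> (B_of t n \<theta> A \<Lambda>)" for \<Lambda>
    unfolding B_of_def by (rule theI'[OF ex1])
  have B_of_eq: "B_of t n \<theta> A \<Lambda> = B" if "has_places t n \<theta> A \<Lambda> B" for \<Lambda> B
    unfolding B_of_def by (rule the1_equality[OF ex1 that])
  show "orbit t n \<theta> A = {lchar t n \<theta> (B_of t n \<theta> A \<Lambda>) | \<Lambda>. \<Lambda> \<in> places t n A \<rightarrow>\<^sub>E (UNIV :: 'a set)}"
  proof (intro subset_antisym subsetI)
    fix c assume "c \<in> orbit t n \<theta> A"
    then obtain B where B: "B \<in> orb A" "c = lchar t n \<theta> B" unfolding orbit_eq by blast
    let ?L = "\<lambda>p \<in> places t n A. entry B (fst p) (snd p)"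
    have "has_places t n \<theta> A ?L B"
      unfolding has_places_iff[OF th] using B(1) by auto
    then have "c = lchar t n \<theta> (B_of t n \<theta> A ?L)" using B_of_eq B(2) by simp
    moreover have "?L \<in> places t n A \<rightarrow>\<^sub>E UNIV" by auto
    ultimately show "c \<in> {lchar t n \<theta> (B_of t n \<theta> A \<Lambda>) | \<Lambda>. \<Lambda> \<in> places t n A \<rightarrow>\<^sub>E (UNIV :: 'a set)}"
      by blast
  next
    fix c assume "c \<in> {lchar t n \<theta> (B_of t n \<theta> A \<Lambda>) | \<Lambda>. \<Lambda> \<in> places t n A \<rightarrow>\<^sub>E (UNIV :: 'a set)}"
    then show "c \<in> orbit t n \<theta> A" using B_of unfolding has_places_def by blast
  qed
  have core: "A\<^sub>0 \<in> V \<and> lchar t n \<theta> A\<^sub>0 \<in> orbit t n \<theta> A \<and> core_character t n A\<^sub>0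
      \<longleftrightarrow> has_places t n \<theta> A (\<lambda>_ \<in> places t n A. 0) A\<^sub>0" for A\<^sub>0
  proof -
    have "A\<^sub>0 \<in> V \<and> lchar t n \<theta> A\<^sub>0 \<in> orbit t n \<theta> A \<longleftrightarrow> A\<^sub>0 \<in> orb A"
      unfolding orbit_eq using lchar_inj[OF th] orb_in_V by blast
    moreover have "(\<forall>(i, j) \<in> places t n A. entry A\<^sub>0 i j = (\<lambda>_ \<in> places t n A. 0) (i, j))
        \<longleftrightarrow> (\<forall>(i, j) \<in> places t n A. entry A\<^sub>0 i j = 0)"
      by auto
    ultimately show ?thesis
      unfolding has_places_iff[OF th] using core_character_iff[OF A st] by blast
  qed
  show "{A\<^sub>0 \<in> V. lchar t n \<theta> A\<^sub>0 \<in> orbit t n \<theta> A \<and> core_character t n A\<^sub>0}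
      = {B_of t n \<theta> A (\<lambda>_ \<in> places t n A. 0)}"
    unfolding core using B_of B_of_eq by blast
qed

end

text \<open>Translation by 1 permutes the field, so comparing the sums of all elements gives q = 0
  in it. With q odd and 2 = 0 this would read 1 = 0.\<close>

lemma two_nonzero_of_odd_card:
  assumes "odd (card (UNIV :: 'a :: {field, finite} set))"
  shows "(2 :: 'a) \<noteq> 0"
proof
  assume two: "(2 :: 'a) = 0"
  have "(\<Sum>x\<in>UNIV. x + 1) = (\<Sum>x\<in>UNIV. x :: 'a)"
    by (rule sum.reindex_bij_witness[of _ "\<lambda>x. x - 1" "\<lambda>x. x + 1"]) auto
  then have z: "of_nat (card (UNIV :: 'a set)) = (0 :: 'a)" by (simp add: sum.distrib)
  obtain r where "card (UNIV :: 'a set) = 2 * r + 1" using assms by (rule oddE)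
  then have "of_nat (card (UNIV :: 'a set)) = (2 :: 'a) * of_nat r + 1" by simp
  then show False using z two by simp
qed

theorem theorem6p7:
  fixes t :: classical_type and n p k q :: nat
    and \<theta> :: "'a :: {field, finite} \<Rightarrow> complex" and A :: "'a mat"
  assumes "prime p" and "odd p" and "q = p ^ k" and "card (UNIV :: 'a set) = q"
    and "nontrivial_additive_character \<theta>"
    and "A \<in> Vset t n" and "staircase t n A"
  shows "(\<forall>\<Lambda> \<in> places t n A \<rightarrow>\<^sub>E (UNIV :: 'a set). \<exists>!B. has_places t n \<theta> A \<Lambda> B)
    \<and> orbit t n \<theta> A =
        {lchar t n \<theta> (B_of t n \<theta> A \<Lambda>) | \<Lambda>. \<Lambda> \<in> places t n A \<rightarrow>\<^sub>E (UNIV :: 'a set)}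
    \<and> {A\<^sub>0 \<in> Vset t n. lchar t n \<theta> A\<^sub>0 \<in> orbit t n \<theta> A \<and> core_character t n A\<^sub>0} =
        {B_of t n \<theta> A (\<lambda>_ \<in> places t n A. 0)}
    \<and> card (orbit t n \<theta> A) = q ^ card (places t n A)
    \<and> q ^ card (places t n A) = q ^ card (Limb t n A)
    \<and> q ^ card (Limb t n A) = q ^ card (Limb t n (verge t n A))
    \<and> q ^ card (Limb t n (verge t n A)) = card (rcosets\<^bsub>Ugrp t n\<^esub> (UJ t n A))"
proof -
  have "odd (card (UNIV :: 'a set))" using assms by simp
  then interpret classical_group t n "TYPE('a)"
    by unfold_locales (rule two_nonzero_of_odd_card)
  note A = assms(6) and st = assms(7) and th = assms(5)
  let ?V = "verge t n A"
  have mV: "mains ?V = mains A" by (rule mains_verge)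
  have stV: "staircase t n ?V" using st staircase_cong[OF mV] by simp
  have pV: "places t n ?V = places t n A" by (rule places_cong[OF mV])
  have LV: "Limb t n ?V = Limb t n A" by (rule Limb_cong[OF mV])
  have pL: "card (places t n A) = card (Limb t n A)" by (rule card_places_eq_card_Limb[OF st])
  have c: "card (orbit t n \<theta> A) = q ^ card (places t n A)"
    using card_orbit[OF th] card_orb[OF A st] assms(4) by simp
  \<comment> \<open>The index is the orbit size of \<open>?V\<close> rather than of A; the exponents
    agree since both have the same places.\<close>
  have r: "card (rcosets\<^bsub>Ugrp t n\<^esub> (UJ t n A)) = q ^ card (places t n A)"
    using card_rcosets_UJ[of A] card_orb[OF verge_in_V stV] pV assms(4) by simp
  show ?thesis
    using staircase_orbit[OF th A st] c r pL LV by simp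
qed

end
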